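(* Let $G$ and $H$ be non-trivial groups, each of which is finite or countably infinite. Then the following statements are equivalent: (1) the free product $G*H$ admits a faithful and highly transitive action on a countably infinite set; (2) at least one of the factors $G$, $H$ is not isomorphic to the cyclic group $\mathbf{Z}/2\mathbf{Z}$.
   Context: An action of a group $\Gamma$ on a set $X$ is faithful if the corresponding homomorphism $\Gamma\to\mathrm{Sym}(X)$ is injective. For a countably infinite group $\Gamma$ and a countably infinite set $X$, an action $\Gamma\curvearrowright X$ is called highly transitive if for every integer $k\ge 1$ the diagonal action of $\Gamma$ on $X^{(k)}=\{(x_1,\dots,x_k)\in X^k : x_i\neq x_j \text{ for all } i\neq j\}$ is transitive. *)

theory Defs
  imports "HOL-Algebra.Group_Action" "HOL-Algebra.Elementary_Groups" "HOL-Library.Countable_Set"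
begin

section \<open>Free product of two groups\<close>

text \<open>
  Elements are reduced words: lists of non-identity letters, taken alternately from the two factors.
\<close>

definition reduced_words ::
  "('a, 'm) monoid_scheme \<Rightarrow> ('b, 'n) monoid_scheme \<Rightarrow> ('a + 'b) list set" where
  "reduced_words G H =
     {w. set w \<subseteq> Inl ` (carrier G - {\<one>\<^bsub>G\<^esub>}) \<union> Inr ` (carrier H - {\<one>\<^bsub>H\<^esub>})
       \<and> successively (\<lambda>x y. isl x \<noteq> isl y) w}"

fun cons_letter ::
  "('a, 'm) monoid_scheme \<Rightarrow> ('b, 'n) monoid_scheme \<Rightarrow> 'a + 'b \<Rightarrow> ('a + 'b) list \<Rightarrow> ('a + 'b) list" where
  "cons_letter G H (Inl g) w = (if g = \<one>\<^bsub>G\<^esub> then w else Inl g # w)"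
| "cons_letter G H (Inr h) w = (if h = \<one>\<^bsub>H\<^esub> then w else Inr h # w)"

text \<open>
  Left multiplication of a reduced word by one letter. After a cancellation no further reduction is
  needed, because the rest of the word starts with a letter of the other factor.
\<close>

fun letter_mult ::
  "('a, 'm) monoid_scheme \<Rightarrow> ('b, 'n) monoid_scheme \<Rightarrow> 'a + 'b \<Rightarrow> ('a + 'b) list \<Rightarrow> ('a + 'b) list" where
  "letter_mult G H (Inl g) (Inl g' # w) = cons_letter G H (Inl (g \<otimes>\<^bsub>G\<^esub> g')) w"
| "letter_mult G H (Inr h) (Inr h' # w) = cons_letter G H (Inr (h \<otimes>\<^bsub>H\<^esub> h')) w"
| "letter_mult G H x w = cons_letter G H x w"

definition free_product ::
  "('a, 'm) monoid_scheme \<Rightarrow> ('b, 'n) monoid_scheme \<Rightarrow> ('a + 'b) list monoid" where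
  "free_product G H =
     \<lparr>carrier = reduced_words G H,
      monoid.mult = (\<lambda>u v. foldr (letter_mult G H) u v),
      one = []\<rparr>"

lemma free_product_simps [simp]:
  "carrier (free_product G H) = reduced_words G H"
  "u \<otimes>\<^bsub>free_product G H\<^esub> v = foldr (letter_mult G H) u v"
  "\<one>\<^bsub>free_product G H\<^esub> = []"
  by (simp_all add: free_product_def)

lemma Nil_reduced [simp]: "[] \<in> reduced_words G H"
  by (simp add: reduced_words_def)

lemma Cons_reduced_iff:
  "x # w \<in> reduced_words G H \<longleftrightarrow>
     x \<in> Inl ` (carrier G - {\<one>\<^bsub>G\<^esub>}) \<union> Inr ` (carrier H - {\<one>\<^bsub>H\<^esub>})
     \<and> w \<in> reduced_words G H \<and> (w = [] \<or> isl x \<noteq> isl (hd w))"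
  by (auto simp: reduced_words_def successively_Cons)

lemma letter_mult_reduced:
  assumes "group G" "group H" "x \<in> Inl ` carrier G \<union> Inr ` carrier H" "w \<in> reduced_words G H"
  shows "letter_mult G H x w \<in> reduced_words G H"
proof -
  interpret G: group G by fact
  interpret H: group H by fact
  show ?thesis
    using assms(3,4)
    by (cases w; cases x; cases "hd w") (auto simp: Cons_reduced_iff)
qed

lemma letter_mult_Inl_Inl:
  assumes "group G" "group H" "g \<in> carrier G" "g' \<in> carrier G" "w \<in> reduced_words G H"
  shows "letter_mult G H (Inl g) (letter_mult G H (Inl g') w) = letter_mult G H (Inl (g \<otimes>\<^bsub>G\<^esub> g')) w"
proof -
  interpret G: group G by fact
  show ?thesis
  proof (cases w)
    case Nil
    then show ?thesis using assms by auto
  next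
    case (Cons y w')
    then show ?thesis using assms
      by (cases y; cases w'; cases "hd w'") (auto simp: Cons_reduced_iff G.m_assoc)
  qed
qed

lemma letter_mult_Inr_Inr:
  assumes "group G" "group H" "h \<in> carrier H" "h' \<in> carrier H" "w \<in> reduced_words G H"
  shows "letter_mult G H (Inr h) (letter_mult G H (Inr h') w) = letter_mult G H (Inr (h \<otimes>\<^bsub>H\<^esub> h')) w"
proof -
  interpret H: group H by fact
  show ?thesis
  proof (cases w)
    case Nil
    then show ?thesis using assms by auto
  next
    case (Cons y w')
    then show ?thesis using assms
      by (cases y; cases w'; cases "hd w'") (auto simp: Cons_reduced_iff H.m_assoc)
  qed
qed

lemma letter_mult_one:
  assumes "group G" "group H" "w \<in> reduced_words G H"
  shows "letter_mult G H (Inl \<one>\<^bsub>G\<^esub>) w = w" "letter_mult G H (Inr \<one>\<^bsub>H\<^esub>) w = w"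
proof -
  interpret G: group G by fact
  interpret H: group H by fact
  show "letter_mult G H (Inl \<one>\<^bsub>G\<^esub>) w = w" "letter_mult G H (Inr \<one>\<^bsub>H\<^esub>) w = w"
    using assms(3) by (cases w; cases "hd w"; auto simp: Cons_reduced_iff)+
qed

lemma foldr_letter_mult_reduced:
  assumes "group G" "group H" "set u \<subseteq> Inl ` carrier G \<union> Inr ` carrier H" "w \<in> reduced_words G H"
  shows "foldr (letter_mult G H) u w \<in> reduced_words G H"
  using assms(3) by (induction u) (auto intro!: letter_mult_reduced assms)

lemma set_reduced_word:
  "u \<in> reduced_words G H \<Longrightarrow> set u \<subseteq> Inl ` carrier G \<union> Inr ` carrier H"
  by (auto simp: reduced_words_def)

lemma cons_letter_eq_letter_mult:
  "x # w \<in> reduced_words G H \<Longrightarrow> letter_mult G H x w = x # w"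
  by (cases x; cases w; cases "hd w") (auto simp: Cons_reduced_iff)

lemma foldr_letter_mult_Nil:
  "u \<in> reduced_words G H \<Longrightarrow> foldr (letter_mult G H) u [] = u"
  by (induction u) (auto simp: cons_letter_eq_letter_mult Cons_reduced_iff[of _ _ G H])

lemma foldr_letter_mult_letter_mult:
  assumes "group G" "group H" "x \<in> Inl ` carrier G \<union> Inr ` carrier H"
    "v \<in> reduced_words G H" "w \<in> reduced_words G H"
  shows "foldr (letter_mult G H) (letter_mult G H x v) w
       = letter_mult G H x (foldr (letter_mult G H) v w)"
proof -
  interpret G: group G by fact
  interpret H: group H by fact
  have c: "foldr (letter_mult G H) (cons_letter G H x v) w
       = letter_mult G H x (foldr (letter_mult G H) v w)"
    if "x \<in> Inl ` carrier G \<union> Inr ` carrier H" "v \<in> reduced_words G H" for x v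
    using that foldr_letter_mult_reduced[OF assms(1,2) set_reduced_word[OF that(2)] assms(5)]
    by (cases x) (auto simp: letter_mult_one assms(1,2))
  show ?thesis
  proof (cases v)
    case Nil
    then show ?thesis using c[OF assms(3), of "[]"] by (cases x) auto
  next
    case (Cons y v')
    then have v': "v' \<in> reduced_words G H" and y: "y \<in> Inl ` carrier G \<union> Inr ` carrier H"
      using assms(4) by (auto simp: Cons_reduced_iff)
    have r: "foldr (letter_mult G H) v' w \<in> reduced_words G H"
      by (rule foldr_letter_mult_reduced[OF assms(1,2) set_reduced_word[OF v'] assms(5)])
    show ?thesis
    proof (cases "isl x = isl y")
      case False
      then have "letter_mult G H x v = cons_letter G H x v" using Cons by (cases x; cases y) auto
      then show ?thesis using c[OF assms(3,4)] by simp
    next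
      case True
      show ?thesis
      proof (cases x)
        case (Inl g)
        then obtain g' where g': "y = Inl g'" using True by (cases y) auto
        have "g \<in> carrier G" "g' \<in> carrier G" using Inl g' assms(3) y by auto
        then show ?thesis
          using c[OF _ v', of "Inl (g \<otimes>\<^bsub>G\<^esub> g')"] Inl g' Cons
          by (simp add: letter_mult_Inl_Inl[OF assms(1,2) _ _ r])
      next
        case (Inr h)
        then obtain h' where h': "y = Inr h'" using True by (cases y) auto
        have "h \<in> carrier H" "h' \<in> carrier H" using Inr h' assms(3) y by auto
        then show ?thesis
          using c[OF _ v', of "Inr (h \<otimes>\<^bsub>H\<^esub> h')"] Inr h' Cons
          by (simp add: letter_mult_Inr_Inr[OF assms(1,2) _ _ r])
      qed
    qed
  qed
qed

lemma foldr_letter_mult_assoc: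
  assumes "group G" "group H" "set u \<subseteq> Inl ` carrier G \<union> Inr ` carrier H"
    "v \<in> reduced_words G H" "w \<in> reduced_words G H"
  shows "foldr (letter_mult G H) (foldr (letter_mult G H) u v) w
       = foldr (letter_mult G H) u (foldr (letter_mult G H) v w)"
  using assms(3)
  by (induction u)
     (auto simp: foldr_letter_mult_letter_mult[OF assms(1,2) _ foldr_letter_mult_reduced] assms)

theorem group_free_product:
  assumes "group G" "group H"
  shows "group (free_product G H)"
proof -
  interpret G: group G by fact
  interpret H: group H by fact
  have inv: "\<exists>v \<in> reduced_words G H. foldr (letter_mult G H) v u = []" if "u \<in> reduced_words G H" for u
    using that
  proof (induction u)
    case Nil
    then show ?case by (intro bexI[of _ "[]"]) auto
  next
    case (Cons x u)
    then have u: "u \<in> reduced_words G H" by (simp add: Cons_reduced_iff)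
    obtain v where v: "v \<in> reduced_words G H" "foldr (letter_mult G H) v u = []"
      using Cons.IH u by blast
    obtain x' where x': "[x'] \<in> reduced_words G H" "letter_mult G H x' (x # u) = u"
    proof (cases x)
      case (Inl g)
      then have "g \<in> carrier G" "g \<noteq> \<one>\<^bsub>G\<^esub>" using Cons.prems by (auto simp: Cons_reduced_iff)
      then show ?thesis using Inl that[of "Inl (inv\<^bsub>G\<^esub> g)"]
        by (simp add: Cons_reduced_iff G.inv_eq_1_iff image_iff)
    next
      case (Inr h)
      then have "h \<in> carrier H" "h \<noteq> \<one>\<^bsub>H\<^esub>" using Cons.prems by (auto simp: Cons_reduced_iff)
      then show ?thesis using Inr that[of "Inr (inv\<^bsub>H\<^esub> h)"]
        by (simp add: Cons_reduced_iff H.inv_eq_1_iff image_iff)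
    qed
    let ?v = "foldr (letter_mult G H) v [x']"
    have "?v \<in> reduced_words G H"
      using foldr_letter_mult_reduced[OF assms set_reduced_word[OF v(1)] x'(1)] .
    moreover have "foldr (letter_mult G H) ?v (x # u) = []"
      using foldr_letter_mult_assoc[OF assms set_reduced_word[OF v(1)] x'(1) Cons.prems] x' v by simp
    ultimately show ?case by blast
  qed
  show ?thesis
    using inv
    by (intro groupI)
       (auto intro: foldr_letter_mult_reduced[OF assms] foldr_letter_mult_assoc[OF assms]
             dest: set_reduced_word)
qed

text \<open>The free product is the coproduct of the two groups.\<close>

lemma hom_Inl_free_product:
  assumes "group G" "group H"
  shows "(\<lambda>g. cons_letter G H (Inl g) []) \<in> hom G (free_product G H)"
proof -
  interpret G: group G by fact
  show ?thesis using assms by (auto simp: hom_def Cons_reduced_iff)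
qed

lemma hom_Inr_free_product:
  assumes "group G" "group H"
  shows "(\<lambda>h. cons_letter G H (Inr h) []) \<in> hom H (free_product G H)"
proof -
  interpret H: group H by fact
  show ?thesis using assms by (auto simp: hom_def Cons_reduced_iff)
qed

theorem free_product_universal:
  assumes "group G" "group H" "group K" "f \<in> hom G K" "f' \<in> hom H K"
  shows "\<exists>F \<in> hom (free_product G H) K.
           (\<forall>g \<in> carrier G. F (cons_letter G H (Inl g) []) = f g)
         \<and> (\<forall>h \<in> carrier H. F (cons_letter G H (Inr h) []) = f' h)
         \<and> (\<forall>F' \<in> hom (free_product G H) K.
              (\<forall>g \<in> carrier G. F' (cons_letter G H (Inl g) []) = f g) \<longrightarrow>
              (\<forall>h \<in> carrier H. F' (cons_letter G H (Inr h) []) = f' h) \<longrightarrow>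
              (\<forall>w \<in> reduced_words G H. F' w = F w))"
proof -
  interpret G: group G by fact
  interpret H: group H by fact
  interpret K: group K by fact
  interpret P: group "free_product G H" by (rule group_free_product) fact+
  interpret f: group_hom G K f by unfold_locales fact
  interpret f': group_hom H K f' by unfold_locales fact
  let ?L = "Inl ` carrier G \<union> Inr ` carrier H"
  define F where "F w = foldr (\<lambda>x a. case_sum f f' x \<otimes>\<^bsub>K\<^esub> a) w \<one>\<^bsub>K\<^esub>" for w
  have F_closed: "F w \<in> carrier K" if "set w \<subseteq> ?L" for w
    using that by (induction w) (auto simp: F_def)
  have F_letter: "F (letter_mult G H x w) = case_sum f f' x \<otimes>\<^bsub>K\<^esub> F w"
    if "x \<in> ?L" "w \<in> reduced_words G H" for x w
  proof (cases w)
    case Nil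
    then show ?thesis using that by (cases x) (auto simp: F_def)
  next
    case (Cons y v)
    have s: "set v \<subseteq> ?L" using that(2) Cons set_reduced_word by fastforce
    have Fv: "F v \<in> carrier K" by (rule F_closed) (rule s)
    have F_Cons: "F (z # v) = case_sum f f' z \<otimes>\<^bsub>K\<^esub> F v" for z by (simp add: F_def)
    have F_Cons2: "F (z # z' # v) = case_sum f f' z \<otimes>\<^bsub>K\<^esub> (case_sum f f' z' \<otimes>\<^bsub>K\<^esub> F v)" for z z'
      by (simp add: F_def)
    have z: "f g \<otimes>\<^bsub>K\<^esub> (f g' \<otimes>\<^bsub>K\<^esub> a) = a"
      if "g \<in> carrier G" "g' \<in> carrier G" "g \<otimes>\<^bsub>G\<^esub> g' = \<one>\<^bsub>G\<^esub>" "a \<in> carrier K" for g g' a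
      using that f.hom_mult[of g g'] by (simp add: K.m_assoc[symmetric])
    have z': "f' g \<otimes>\<^bsub>K\<^esub> (f' g' \<otimes>\<^bsub>K\<^esub> a) = a"
      if "g \<in> carrier H" "g' \<in> carrier H" "g \<otimes>\<^bsub>H\<^esub> g' = \<one>\<^bsub>H\<^esub>" "a \<in> carrier K" for g g' a
      using that f'.hom_mult[of g g'] by (simp add: K.m_assoc[symmetric])
    show ?thesis using that Cons Fv
      by (cases x; cases y) (auto simp: Cons_reduced_iff F_Cons F_Cons2 z z' K.m_assoc)
  qed
  have F_mult: "F (foldr (letter_mult G H) u w) = F u \<otimes>\<^bsub>K\<^esub> F w"
    if "set u \<subseteq> ?L" "w \<in> reduced_words G H" for u w
    using that(1)
  proof (induction u)
    case Nil
    have "F w \<in> carrier K" by (rule F_closed) (rule set_reduced_word[OF that(2)])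
    then show ?case by (simp add: F_def[of "[]"])
  next
    case (Cons x u)
    have r: "foldr (letter_mult G H) u w \<in> reduced_words G H"
      using foldr_letter_mult_reduced[OF assms(1,2) _ that(2)] Cons.prems by simp
    have c: "F u \<in> carrier K" "F w \<in> carrier K" "case_sum f f' x \<in> carrier K"
      using F_closed set_reduced_word[OF that(2)] Cons.prems by auto
    have "F (x # u) = case_sum f f' x \<otimes>\<^bsub>K\<^esub> F u" by (simp add: F_def)
    then show ?case using Cons F_letter[OF _ r, of x] c by (simp add: K.m_assoc)
  qed
  have hom: "F \<in> hom (free_product G H) K"
    using F_closed F_mult set_reduced_word by (force simp: hom_def)
  have 1: "F (cons_letter G H (Inl g) []) = f g" if "g \<in> carrier G" for g
    using that by (auto simp: F_def)
  have 2: "F (cons_letter G H (Inr h) []) = f' h" if "h \<in> carrier H" for h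
    using that by (auto simp: F_def)
  have 3: "F' w = F w"
    if F': "F' \<in> hom (free_product G H) K"
      and a: "\<forall>g \<in> carrier G. F' (cons_letter G H (Inl g) []) = f g"
             "\<forall>h \<in> carrier H. F' (cons_letter G H (Inr h) []) = f' h"
      and w: "w \<in> reduced_words G H" for F' w
    using w
  proof (induction w)
    case Nil
    have "F' [] = \<one>\<^bsub>K\<^esub>" using hom_one[OF F'] P.is_group K.is_group by simp
    then show ?case by (simp add: F_def)
  next
    case (Cons x w)
    have w: "w \<in> reduced_words G H" and x: "[x] \<in> reduced_words G H"
      using Cons.prems by (auto simp: Cons_reduced_iff)
    have "F' (x # w) = F' ([x] \<otimes>\<^bsub>free_product G H\<^esub> w)"
      using cons_letter_eq_letter_mult[OF Cons.prems] by simp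
    also have "\<dots> = F' [x] \<otimes>\<^bsub>K\<^esub> F' w"
      using hom_mult[OF F', of "[x]" w] w x by simp
    also have "F' [x] = case_sum f f' x"
      using a x by (cases x) (auto simp: Cons_reduced_iff split: if_splits)
    finally show ?case using Cons.IH w by (simp add: F_def)
  qed
  show ?thesis
    by (intro bexI[of _ F] conjI ballI impI; (fact hom | rule 1 | rule 2 | rule 3); assumption?)
qed


section \<open>Highly transitive actions\<close>

text \<open>The set $X^{(k)}$ of $k$-tuples of pairwise distinct points, with tuples encoded as lists.\<close>

definition distinct_tuples :: "nat \<Rightarrow> 'x set \<Rightarrow> 'x list set" where
  "distinct_tuples k X = {xs. length xs = k \<and> distinct xs \<and> set xs \<subseteq> X}"

text \<open>The restriction is needed because elements of \<^const>\<open>BijGroup\<close> are extensional functions.\<close>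

definition diagonal_action :: "nat \<Rightarrow> 'x set \<Rightarrow> ('g \<Rightarrow> 'x \<Rightarrow> 'x) \<Rightarrow> 'g \<Rightarrow> 'x list \<Rightarrow> 'x list" where
  "diagonal_action k X \<phi> g = (\<lambda>xs \<in> distinct_tuples k X. map (\<phi> g) xs)"

locale highly_transitive_action = group_action +
  assumes diagonal_transitive:
    "k \<ge> 1 \<Longrightarrow> transitive_action G (distinct_tuples k E) (diagonal_action k E \<phi>)"

lemma group_action_diagonal:
  assumes "group_action G X \<phi>"
  shows "group_action G (distinct_tuples k X) (diagonal_action k X \<phi>)"
proof -
  interpret group_action G X \<phi> by fact
  interpret group_hom G "BijGroup X" \<phi> by (rule group_hom)
  let ?D = "distinct_tuples k X" and ?d = "diagonal_action k X \<phi>"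
  have closed: "map (\<phi> g) xs \<in> ?D" if "g \<in> carrier G" "xs \<in> ?D" for g xs
    using that element_image[OF that(1)] inj_on_subset[OF inj_prop[OF that(1)]]
    by (auto simp: distinct_tuples_def distinct_map)
  have comp: "map (\<phi> g) (map (\<phi> h) xs) = map (\<phi> (g \<otimes>\<^bsub>G\<^esub> h)) xs"
    if "g \<in> carrier G" "h \<in> carrier G" "xs \<in> ?D" for g h xs
    using that by (auto simp: distinct_tuples_def subset_iff composition_rule simp del: hom_mult)
  have one: "map (\<phi> \<one>\<^bsub>G\<^esub>) xs = xs" if "xs \<in> ?D" for xs
    using that by (intro map_idI) (auto simp: distinct_tuples_def subset_iff id_eq_one[symmetric] simp del: hom_one)
  have bij: "?d g \<in> Bij ?D" if g: "g \<in> carrier G" for g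
  proof -
    have "bij_betw (?d g) ?D ?D"
      using closed[OF g] closed[OF G.inv_closed[OF g]]
        comp[of "inv\<^bsub>G\<^esub> g" g] comp[of g "inv\<^bsub>G\<^esub> g"] one g
      by (intro bij_betw_byWitness[where f' = "?d (inv\<^bsub>G\<^esub> g)"])
         (auto simp: diagonal_action_def simp del: map_map hom_one hom_mult hom_inv)
    then show ?thesis by (auto simp: Bij_def diagonal_action_def)
  qed
  have "?d (g \<otimes>\<^bsub>G\<^esub> h) = compose ?D (?d g) (?d h)" if "g \<in> carrier G" "h \<in> carrier G" for g h
    using that comp[of g h] closed[of h]
    by (auto simp: diagonal_action_def compose_def fun_eq_iff simp del: map_map)
  then have "?d \<in> hom G (BijGroup ?D)"
    using bij by (auto simp: hom_def BijGroup_def)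
  then show ?thesis
    by (intro group_action.intro group_hom.intro group_hom_axioms.intro group_BijGroup G.is_group)
qed

lemma highly_transitive_action_iff:
  "highly_transitive_action G X \<phi> \<longleftrightarrow>
     group_action G X \<phi> \<and>
     (\<forall>k \<ge> 1. \<forall>xs \<in> distinct_tuples k X. \<forall>ys \<in> distinct_tuples k X.
        \<exists>g \<in> carrier G. map (\<phi> g) xs = ys)"
  by (auto simp: highly_transitive_action_def highly_transitive_action_axioms_def
      transitive_action_def transitive_action_axioms_def group_action_diagonal)
     (auto simp: diagonal_action_def)

end

theory Submission
  imports Defs
begin

text \<open>
  Existence of the action. By symmetry \<open>H\<close> may be taken to have three different elements
  \<open>\<one>, h, h'\<close>, while \<open>G\<close> has an element \<open>g \<noteq> \<one>\<close>. Let both groups act freely on \<open>\<nat>\<close> with infinitely many orbits. Every bijection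
  \<open>\<sigma>\<close> of \<open>\<nat>\<close> gives an action of \<open>G * H\<close>: let \<open>G\<close> act as given, and \<open>H\<close> through the
  conjugates by \<open>\<sigma>\<close>. A generic \<open>\<sigma>\<close> works, and it is found by forcing with finite partial
  injections. Two countable families of requirements have to be dense: a given reduced word moves a
  point, and a given finite injection \<open>\<pi>\<close>, with range disjoint from its domain, is realised by a
  word. Only \<^emph>\<open>open\<close> injections serve as conditions, namely those whose domain contains no
  nonempty invariant set: a finite orbit could never be repaired later.

  Density rests on a tree-like completion of a finite partial injection (\<open>ranked_extension\<close>). Add
  one value at a time, always placing the new point in a fresh \<open>G\<close>-orbit or its image in a fresh
  \<open>H\<close>-orbit, and let the rank of a point be the stage at which it entered the domain. A point of
  positive rank is then the strict minimum of its \<open>G\<close>-orbit or of its \<open>H\<close>-orbit, so that once a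
  path of a reduced word moves upwards it climbs forever. In particular every nontrivial reduced
  word moves some point, which settles faithfulness.

  For high transitivity the main step is \<open>escape\<close>: a finite set \<open>F\<close> can be moved by one word, in
  such a way that all the end points are points at which \<open>\<sigma>\<close> has not been used on the way, and so
  are still free to be redefined. Iterating \<open>g h\<close>, every point runs upwards to infinity, except
  the finitely many points on finite cycles, all of rank 0; those can be moved off the cycles one
  after another, because the points that are already running can be sent away beforehand by a
  multiple of the cycle length. Finally the letter \<open>h'\<close> in place of \<open>h\<close> makes each point leave
  its \<open>g h\<close>-line, in a direction in which no other point has travelled. At the end points one may
  now prescribe \<open>\<sigma>\<close> so that the single letter \<open>h\<close> carries the end point of each \<open>x\<close> to that of
  \<open>\<pi> x\<close> (\<open>glue\<close>); the third element \<open>h'\<close> leaves every orbit used here incomplete, and so the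
  condition stays open. Conjugating \<open>h\<close> by the escaping word realises \<open>\<pi>\<close>.

  Conversely, in the infinite dihedral group the product \<open>c\<close> of the two generating involutions
  satisfies \<open>w c w\<^sup>-\<^sup>1 \<in> {c, c\<^sup>-\<^sup>1}\<close> for all \<open>w\<close>. Hence an element fixing \<open>x\<close> carries \<open>c x\<close> to
  one of only two points, which excludes 2-transitivity on an infinite set.
\<close>

section \<open>Free actions and words in the two factors\<close>

locale free_action = group G for G (structure) +
  fixes act :: "'a \<Rightarrow> 'x \<Rightarrow> 'x"
  assumes act_one [simp]: "act \<one> x = x"
    and act_mult: "g \<in> carrier G \<Longrightarrow> k \<in> carrier G \<Longrightarrow> act (g \<otimes> k) x = act g (act k x)"
    and act_free: "g \<in> carrier G \<Longrightarrow> act g x = x \<Longrightarrow> g = \<one>"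
begin

lemma act_inv [simp]:
  assumes "g \<in> carrier G"
  shows "act (inv g) (act g x) = x" "act g (act (inv g) x) = x"
  using assms act_mult[of "inv g" g x] act_mult[of g "inv g" x] by auto

lemma act_eq_iff:
  assumes "g \<in> carrier G"
  shows "act g x = act g y \<longleftrightarrow> x = y"
  using act_inv(1)[OF assms] by metis

lemma act_eq_act:
  assumes "g \<in> carrier G" "k \<in> carrier G" "act g x = act k y"
  shows "act (inv k \<otimes> g) x = y"
  using assms by (simp add: act_mult)

lemma act_left_cancel:
  assumes "g \<in> carrier G" "k \<in> carrier G" "act g x = act k x"
  shows "g = k"
proof -
  have "inv k \<otimes> g = \<one>"
    using act_eq_act[OF assms] assms by (intro act_free) auto
  then show ?thesis
    using assms by (metis inv_closed inv_equality inv_inv)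
qed

end

definition words :: "('a, 'm) monoid_scheme \<Rightarrow> ('b, 'n) monoid_scheme \<Rightarrow> ('a + 'b) list set" where
  "words G H = lists (Inl ` carrier G \<union> Inr ` carrier H)"

lemma words_simps [simp]:
  "[] \<in> words G H"
  "Inl g # w \<in> words G H \<longleftrightarrow> g \<in> carrier G \<and> w \<in> words G H"
  "Inr h # w \<in> words G H \<longleftrightarrow> h \<in> carrier H \<and> w \<in> words G H"
  "u @ w \<in> words G H \<longleftrightarrow> u \<in> words G H \<and> w \<in> words G H"
  by (auto simp: words_def)

lemma reduced_words_subset_words: "reduced_words G H \<subseteq> words G H"
  by (auto simp: words_def reduced_words_def)

lemma words_induct [consumes 1, case_names Nil Inl Inr]:
  assumes "w \<in> words G H" "P []"
    "\<And>g w. g \<in> carrier G \<Longrightarrow> w \<in> words G H \<Longrightarrow> P w \<Longrightarrow> P (Inl g # w)"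
    "\<And>h w. h \<in> carrier H \<Longrightarrow> w \<in> words G H \<Longrightarrow> P w \<Longrightarrow> P (Inr h # w)"
  shows "P w"
  using assms(1)
proof (induction w)
  case (Cons y w)
  then show ?case using assms by (cases y) auto
qed (use assms in auto)

definition run :: "('a \<Rightarrow> 'x \<Rightarrow> 'x) \<Rightarrow> ('b \<Rightarrow> 'x \<Rightarrow> 'x) \<Rightarrow> ('a + 'b) list \<Rightarrow> 'x \<Rightarrow> 'x" where
  "run a b w x = foldr (case_sum a b) w x"

lemma run_simps [simp]:
  "run a b [] x = x"
  "run a b (Inl g # w) x = a g (run a b w x)"
  "run a b (Inr h # w) x = b h (run a b w x)"
  "run a b (u @ w) x = run a b u (run a b w x)"
  by (simp_all add: run_def)

text \<open>
  The end point belongs to the path because a letter of \<open>H\<close>, acting through a conjugate, uses the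
  conjugating bijection at the point that it leaves and at the point that it reaches.
\<close>

fun trace :: "('a \<Rightarrow> 'x \<Rightarrow> 'x) \<Rightarrow> ('b \<Rightarrow> 'x \<Rightarrow> 'x) \<Rightarrow> ('a + 'b) list \<Rightarrow> 'x \<Rightarrow> 'x set" where
  "trace a b [] x = {x}"
| "trace a b (y # w) x = insert (run a b (y # w) x) (trace a b w x)"

lemma finite_trace [simp]: "finite (trace a b w x)"
  by (induction w) auto

lemma run_in_trace [simp]: "run a b w x \<in> trace a b w x"
  by (cases w) auto

definition conj_act :: "('x \<Rightarrow> 'y) \<Rightarrow> ('b \<Rightarrow> 'y \<Rightarrow> 'y) \<Rightarrow> 'b \<Rightarrow> 'x \<Rightarrow> 'x" where
  "conj_act \<sigma> b h x = inv_into UNIV \<sigma> (b h (\<sigma> x))"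

lemma conj_act_apply:
  assumes "bij \<sigma>"
  shows "\<sigma> (conj_act \<sigma> b h x) = b h (\<sigma> x)"
  using assms by (simp add: conj_act_def bij_is_surj surj_f_inv_f)

lemma conj_act_eqI:
  assumes "bij \<sigma>" "\<sigma> y = b h (\<sigma> x)"
  shows "conj_act \<sigma> b h x = y"
  using assms by (metis conj_act_apply bij_is_inj injD)

lemma free_action_conj_act:
  assumes "free_action H b" "bij \<sigma>"
  shows "free_action H (conj_act \<sigma> b)"
proof -
  interpret free_action H b by fact
  show ?thesis
  proof unfold_locales
    show "conj_act \<sigma> b \<one>\<^bsub>H\<^esub> x = x" for x
      by (rule conj_act_eqI) (use assms in auto)
    show "conj_act \<sigma> b (g \<otimes>\<^bsub>H\<^esub> k) x = conj_act \<sigma> b g (conj_act \<sigma> b k x)"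
      if "g \<in> carrier H" "k \<in> carrier H" for g k x
      by (rule conj_act_eqI) (use assms that in \<open>auto simp: conj_act_apply act_mult\<close>)
    show "g = \<one>\<^bsub>H\<^esub>" if "g \<in> carrier H" "conj_act \<sigma> b g x = x" for g x
      using that act_free[of g "\<sigma> x"] conj_act_apply[OF assms(2), of b g x] by simp
  qed
qed

text \<open>
  A word acts on a point in a way that depends only on the finitely many values of the conjugating
  bijection along the path of that point.
\<close>

lemma run_conj_act_cong:
  assumes "bij \<sigma>" "bij \<tau>"
    and "\<And>q. q \<in> trace a (conj_act \<sigma> b) w x \<Longrightarrow> \<tau> q = \<sigma> q"
  shows "run a (conj_act \<tau> b) w x = run a (conj_act \<sigma> b) w x"
  using assms(3)
proof (induction w)
  case (Cons y w)
  then have IH: "run a (conj_act \<tau> b) w x = run a (conj_act \<sigma> b) w x" by simp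
  show ?case
  proof (cases y)
    case (Inl g)
    then show ?thesis using IH by simp
  next
    case (Inr h)
    let ?q = "run a (conj_act \<sigma> b) w x"
    have "\<tau> ?q = \<sigma> ?q" "\<tau> (conj_act \<sigma> b h ?q) = \<sigma> (conj_act \<sigma> b h ?q)"
      using Cons.prems Inr by auto
    then have "conj_act \<tau> b h ?q = conj_act \<sigma> b h ?q"
      using assms(1,2) by (intro conj_act_eqI) (auto simp: conj_act_apply)
    then show ?thesis using IH Inr by simp
  qed
qed simp

locale free_action_pair = A: free_action G a + B: free_action H b
  for G :: "('a, 'm) monoid_scheme" and H :: "('b, 'n) monoid_scheme"
    and a :: "'a \<Rightarrow> 'x \<Rightarrow> 'x" and b :: "'b \<Rightarrow> 'x \<Rightarrow> 'x"
begin

lemma inverse_word: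
  assumes "w \<in> words G H"
  shows "\<exists>v \<in> words G H. \<forall>x. run a b v (run a b w x) = x \<and> run a b w (run a b v x) = x"
  using assms
proof (induction rule: words_induct)
  case Nil
  show ?case by (rule bexI[of _ "[]"]) auto
next
  case (Inl g w)
  then obtain v where "v \<in> words G H"
    "\<forall>x. run a b v (run a b w x) = x \<and> run a b w (run a b v x) = x" by blast
  with Inl show ?case
    by (intro bexI[of _ "v @ [Inl (inv\<^bsub>G\<^esub> g)]"]) auto
next
  case (Inr h w)
  then obtain v where "v \<in> words G H"
    "\<forall>x. run a b v (run a b w x) = x \<and> run a b w (run a b v x) = x" by blast
  with Inr show ?case
    by (intro bexI[of _ "v @ [Inr (inv\<^bsub>H\<^esub> h)]"]) auto
qed

lemma inj_run:
  assumes "w \<in> words G H"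
  shows "inj (run a b w)"
  using inverse_word[OF assms] by (metis injI)

end

section \<open>Ranked actions\<close>

text \<open>
  The dynamics of the tree-like completion, abstracted from its construction. The points of rank 0
  form the finite core on which the conjugating bijection was prescribed. One may picture every orbit
  of \<open>G\<close> and of \<open>H\<close> as a vertex and every point as an edge joining its two orbits; the condition
  then says that an edge of positive rank was the first one at one of its end vertices.
\<close>

locale ranked_pair = free_action_pair G H a b
  for G :: "('a, 'm) monoid_scheme" and H :: "('b, 'n) monoid_scheme"
    and a :: "'a \<Rightarrow> 'x \<Rightarrow> 'x" and b :: "'b \<Rightarrow> 'x \<Rightarrow> 'x" +
  fixes \<rho> :: "'x \<Rightarrow> nat"
  assumes finite_core: "finite {p. \<rho> p = 0}"
    and strict_min: "\<rho> p > 0 \<Longrightarrow>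
      (\<forall>g \<in> carrier G - {\<one>\<^bsub>G\<^esub>}. \<rho> p < \<rho> (a g p)) \<or> (\<forall>h \<in> carrier H - {\<one>\<^bsub>H\<^esub>}. \<rho> p < \<rho> (b h p))"
begin

text \<open>
  A path that has just left a point of \<open>g_top\<close> by a letter of \<open>G\<close>, or a point of \<open>h_top\<close> by a
  letter of \<open>H\<close>, moves away from the core. The definition of \<open>h_top\<close> as a complement makes the two
  sets disjoint even if a point is minimal in both of its orbits.
\<close>

definition g_top :: "'x set" where
  "g_top = {p. \<rho> p > 0 \<and> (\<forall>g \<in> carrier G - {\<one>\<^bsub>G\<^esub>}. \<rho> p < \<rho> (a g p))}"

definition h_top :: "'x set" where
  "h_top = {p. \<rho> p > 0 \<and> p \<notin> g_top}"

lemma rank_pos_cases: "\<rho> p > 0 \<Longrightarrow> p \<in> g_top \<or> p \<in> h_top"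
  by (auto simp: h_top_def)

lemma g_top_step:
  assumes "p \<in> g_top" "g \<in> carrier G" "g \<noteq> \<one>\<^bsub>G\<^esub>"
  shows "a g p \<in> h_top" "\<rho> p < \<rho> (a g p)"
proof -
  show *: "\<rho> p < \<rho> (a g p)" using assms by (auto simp: g_top_def)
  have "inv\<^bsub>G\<^esub> g \<in> carrier G - {\<one>\<^bsub>G\<^esub>}" using assms by simp
  moreover have "a (inv\<^bsub>G\<^esub> g) (a g p) = p" using assms by simp
  ultimately have "a g p \<notin> g_top" using * by (force simp: g_top_def)
  then show "a g p \<in> h_top" using * by (auto simp: h_top_def)
qed

lemma h_top_step:
  assumes "p \<in> h_top" "h \<in> carrier H" "h \<noteq> \<one>\<^bsub>H\<^esub>"
  shows "b h p \<in> g_top" "\<rho> p < \<rho> (b h p)"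
proof -
  show *: "\<rho> p < \<rho> (b h p)"
    using assms strict_min[of p] by (auto simp: h_top_def g_top_def)
  have "inv\<^bsub>H\<^esub> h \<in> carrier H - {\<one>\<^bsub>H\<^esub>}" using assms by simp
  moreover have "b (inv\<^bsub>H\<^esub> h) (b h p) = p" using assms by simp
  ultimately show "b h p \<in> g_top"
    using * strict_min[of "b h p"] by (force simp: g_top_def)
qed

text \<open>
  The two kinds of steps alternate exactly as the letters of a reduced word do, so that a path which
  starts upwards keeps rising.
\<close>

lemma run_reduced_increases:
  assumes "w \<in> reduced_words G H" "w \<noteq> []"
    and "if isl (last w) then p \<in> g_top else p \<in> h_top"
  shows "\<rho> p < \<rho> (run a b w p) \<and> run a b w p \<in> (if isl (hd w) then h_top else g_top)"
  using assms
proof (induction w)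
  case (Cons y w)
  show ?case
  proof (cases "w = []")
    case True
    then show ?thesis using Cons.prems
      by (cases y) (auto simp: Cons_reduced_iff g_top_step h_top_step)
  next
    case False
    then have IH: "\<rho> p < \<rho> (run a b w p)" "run a b w p \<in> (if isl (hd w) then h_top else g_top)"
      and ne: "isl y \<noteq> isl (hd w)"
      using Cons by (auto simp: Cons_reduced_iff)
    then show ?thesis using Cons.prems(1)
      by (cases y) (auto simp: Cons_reduced_iff dest: g_top_step h_top_step
          intro: less_trans g_top_step(2) h_top_step(2) split: if_splits)
  qed
qed simp

end

text \<open>
  The last assumption says that no orbit of the free product is contained in the core.
\<close>

locale escaping_pair = ranked_pair G H a b \<rho>
  for G :: "('a, 'm) monoid_scheme" and H :: "('b, 'n) monoid_scheme"
    and a :: "'a \<Rightarrow> 'x \<Rightarrow> 'x" and b :: "'b \<Rightarrow> 'x \<Rightarrow> 'x" and \<rho> :: "'x \<Rightarrow> nat" +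
  fixes g :: 'a and h h' :: 'b
  assumes g: "g \<in> carrier G" "g \<noteq> \<one>\<^bsub>G\<^esub>"
    and h: "h \<in> carrier H" "h \<noteq> \<one>\<^bsub>H\<^esub>"
    and h': "h' \<in> carrier H" "h' \<noteq> \<one>\<^bsub>H\<^esub>" "h \<noteq> h'"
    and leaves_core: "\<exists>v \<in> words G H. \<rho> (run a b v p) > 0"
begin

definition drift :: "'x \<Rightarrow> 'x" where
  "drift p = a g (b h p)"

definition drift_word :: "nat \<Rightarrow> ('a + 'b) list" where
  "drift_word n = concat (replicate n [Inl g, Inr h])"

lemma drift_word_simps [simp]:
  "drift_word 0 = []"
  "drift_word (Suc n) = Inl g # Inr h # drift_word n"
  by (simp_all add: drift_word_def)

lemma drift_word_in_words [simp]: "drift_word n \<in> words G H"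
  by (induction n) (use g h in auto)

lemma run_drift_word [simp]: "run a b (drift_word n) p = (drift ^^ n) p"
  by (induction n) (auto simp: drift_def)

lemma inj_drift: "inj drift"
  using A.act_eq_iff[OF g(1)] B.act_eq_iff[OF h(1)] by (auto simp: drift_def inj_def)

lemma h_top_drift:
  assumes "p \<in> h_top"
  shows "drift p \<in> h_top" "\<rho> p < \<rho> (drift p)"
  using h_top_step[OF assms h] g_top_step[of "b h p", OF _ g] by (auto simp: drift_def)

lemma h_top_drift_funpow:
  assumes "p \<in> h_top"
  shows "(drift ^^ n) p \<in> h_top \<and> \<rho> p + n \<le> \<rho> ((drift ^^ n) p)"
proof (induction n)
  case (Suc n)
  then show ?case using h_top_drift[of "(drift ^^ n) p"] by auto
qed (use assms in auto)

text \<open>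
  Points that drift towards the core have to come from further away, because going backwards along
  their path is a climb.
\<close>

lemma g_top_drift_back:
  assumes "drift p \<in> g_top"
  shows "p \<in> g_top" "\<rho> (drift p) < \<rho> p"
proof -
  have "a (inv\<^bsub>G\<^esub> g) (drift p) = b h p" using g by (simp add: drift_def)
  then have 1: "b h p \<in> h_top" "\<rho> (drift p) < \<rho> (b h p)"
    using g_top_step[OF assms, of "inv\<^bsub>G\<^esub> g"] g by auto
  then show "p \<in> g_top" "\<rho> (drift p) < \<rho> p"
    using h_top_step[OF 1(1), of "inv\<^bsub>H\<^esub> h"] h by auto
qed

lemma g_top_drift_funpow_back:
  assumes "(drift ^^ n) p \<in> g_top"
  shows "\<rho> ((drift ^^ n) p) + n \<le> \<rho> p"
  using assms
proof (induction n arbitrary: p)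
  case (Suc n)
  have "(drift ^^ n) (drift p) = (drift ^^ Suc n) p" by (simp only: funpow_Suc_right o_apply)
  with Suc have "(drift ^^ n) (drift p) \<in> g_top" by simp
  moreover have "m \<le> n \<Longrightarrow> (drift ^^ (n - m)) (drift p) \<in> g_top" for m
  proof (induction m)
    case 0
    then show ?case using calculation by simp
  next
    case (Suc m)
    then have "n - m = Suc (n - Suc m)" by simp
    then show ?case using Suc g_top_drift_back(1)[of "(drift ^^ (n - Suc m)) (drift p)"] by simp
  qed
  from this[of n] have "drift p \<in> g_top" by simp
  ultimately show ?case
    using Suc.IH[of "drift p"] g_top_drift_back(2)[of p] by (simp del: funpow.simps add: funpow_Suc_right)
qed simp

definition cyclic_points :: "'x set" where
  "cyclic_points = {p. \<exists>n > 0. (drift ^^ n) p = p}"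

text \<open>
  Along a finite cycle the rank could neither keep rising nor keep falling; it thus has to vanish.
\<close>

lemma rank_cyclic_point:
  assumes "p \<in> cyclic_points"
  shows "\<rho> p = 0"
proof (rule ccontr)
  assume "\<rho> p \<noteq> 0"
  moreover obtain n where n: "n > 0" "(drift ^^ n) p = p"
    using assms by (auto simp: cyclic_points_def)
  ultimately show False
    using rank_pos_cases[of p] h_top_drift_funpow[of p n] g_top_drift_funpow_back[of n p] by auto
qed

text \<open>
  The points of an infinite forward orbit are pairwise different, so the orbit leaves the finite core
  for good. Afterwards it cannot fall forever, and once it rises it does so forever.
\<close>

lemma eventually_deep:
  assumes "p \<notin> cyclic_points"
  shows "eventually (\<lambda>n. (drift ^^ n) p \<in> h_top \<and> B < \<rho> ((drift ^^ n) p)) sequentially"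
proof -
  have "inj (\<lambda>n. (drift ^^ n) p)"
  proof (rule linorder_injI)
    fix m n :: nat
    assume "m < n"
    show "(drift ^^ m) p \<noteq> (drift ^^ n) p"
    proof
      assume "(drift ^^ m) p = (drift ^^ n) p"
      also have "\<dots> = (drift ^^ m) ((drift ^^ (n - m)) p)"
        using \<open>m < n\<close> by (metis add_diff_inverse_nat comp_apply funpow_add less_imp_not_less)
      finally have "(drift ^^ (n - m)) p = p"
        using inj_fn[OF inj_drift] by (metis injD)
      with \<open>m < n\<close> have "p \<in> cyclic_points"
        unfolding cyclic_points_def by (intro CollectI exI[of _ "n - m"]) simp
      with assms show False by simp
    qed
  qed
  then have "finite ((\<lambda>n. (drift ^^ n) p) -` {q. \<rho> q = 0})"
    by (intro finite_vimageI finite_core)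
  then obtain N where N: "\<And>n. \<rho> ((drift ^^ n) p) = 0 \<Longrightarrow> n < N"
    unfolding finite_nat_set_iff_bounded by auto
  have "\<exists>m. (drift ^^ (N + m)) p \<in> h_top"
  proof (rule ccontr)
    assume "\<nexists>m. (drift ^^ (N + m)) p \<in> h_top"
    then have "(drift ^^ (N + m)) p \<in> g_top" for m
      using N[of "N + m"] rank_pos_cases by (metis gr0I not_add_less1)
    from this[of "Suc (\<rho> p)"] show False
      using g_top_drift_funpow_back[of "N + Suc (\<rho> p)" p] by simp
  qed
  then obtain M where M: "(drift ^^ M) p \<in> h_top" by blast
  show ?thesis
    unfolding eventually_sequentially
  proof (intro exI[of _ "M + Suc B"] allI impI)
    fix n
    assume n: "M + Suc B \<le> n"
    then have "(drift ^^ n) p = (drift ^^ (n - M)) ((drift ^^ M) p)"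
      by (metis add.commute add_leD1 comp_apply funpow_add le_add_diff_inverse)
    then show "(drift ^^ n) p \<in> h_top \<and> B < \<rho> ((drift ^^ n) p)"
      using h_top_drift_funpow[OF M, of "n - M"] n by auto
  qed
qed

lemma eventually_deep_finite:
  assumes "finite F" "\<forall>p \<in> F. p \<notin> cyclic_points"
  obtains N where "\<And>n p. N \<le> n \<Longrightarrow> p \<in> F \<Longrightarrow> (drift ^^ n) p \<in> h_top \<and> B < \<rho> ((drift ^^ n) p)"
proof -
  have "eventually (\<lambda>n. \<forall>p \<in> F. (drift ^^ n) p \<in> h_top \<and> B < \<rho> ((drift ^^ n) p)) sequentially"
    using assms by (intro eventually_ball_finite) (auto intro: eventually_deep)
  then show ?thesis using that by (auto simp: eventually_sequentially)
qed

lemma finite_rank_bound: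
  assumes "finite S"
  obtains B where "\<And>q. q \<in> S \<Longrightarrow> \<rho> q \<le> B"
  using finite_nat_set_iff_bounded_le[of "\<rho> ` S"] assms by auto

text \<open>
  This is a case of Neumann's lemma, that a finite set can be moved off another finite set when all
  orbits are infinite; the drift makes an induction over the points of \<open>F\<close> possible.
\<close>

lemma move_off_cyclic_points:
  assumes "finite F"
  shows "\<exists>w \<in> words G H. \<forall>z \<in> F. run a b w z \<notin> cyclic_points"
  using assms
proof (induction F)
  case empty
  show ?case by (rule bexI[of _ "[]"]) auto
next
  case (insert z F)
  then obtain w where w: "w \<in> words G H" "\<forall>z \<in> F. run a b w z \<notin> cyclic_points" by blast
  show ?case
  proof (cases "run a b w z \<in> cyclic_points")
    case False
    with w show ?thesis by blast
  next
    case True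
    then obtain n where n: "n > 0" "(drift ^^ n) (run a b w z) = run a b w z"
      by (auto simp: cyclic_points_def)
    obtain v where v: "v \<in> words G H" "\<rho> (run a b v (run a b w z)) > 0"
      using leaves_core by blast
    have "finite (run a b v -` {q. \<rho> q = 0})"
      by (intro finite_vimageI finite_core inj_run v)
    then obtain B where B: "\<And>q. \<rho> (run a b v q) = 0 \<Longrightarrow> \<rho> q \<le> B"
      by (rule finite_rank_bound) auto
    obtain N where N: "\<And>m p. N \<le> m \<Longrightarrow> p \<in> run a b w ` F \<Longrightarrow>
        (drift ^^ m) p \<in> h_top \<and> B < \<rho> ((drift ^^ m) p)"
      using w(2) insert.hyps(1) by (rule_tac eventually_deep_finite[of "run a b w ` F" B]) auto
    have fixed: "(drift ^^ (n * N)) (run a b w z) = run a b w z"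
      using n(2) by (induction N) (auto simp: funpow_add)
    \<comment> \<open>The exponent is a multiple of the cycle length of the new point, which therefore waits, and it is
        so large that the other points are too far out for \<open>v\<close> to bring them back to the core.\<close>
    have "run a b (v @ drift_word (n * N) @ w) y \<notin> cyclic_points" if "y \<in> insert z F" for y
    proof
      assume "run a b (v @ drift_word (n * N) @ w) y \<in> cyclic_points"
      then have 0: "\<rho> (run a b v ((drift ^^ (n * N)) (run a b w y))) = 0"
        by (auto dest: rank_cyclic_point)
      then have "y \<noteq> z" using v(2) fixed by auto
      with that have "y \<in> F" by simp
      with N[of "n * N" "run a b w y"] n(1) have "B < \<rho> ((drift ^^ (n * N)) (run a b w y))"
        by simp
      with B[OF 0] show False by simp
    qed
    then show ?thesis
      using v(1) w(1) by (intro bexI[of _ "v @ drift_word (n * N) @ w"]) auto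
  qed
qed

lemma trace_drift_word:
  assumes "\<And>m. m < n \<Longrightarrow> (drift ^^ m) (run a b w z) \<in> h_top"
  shows "trace a b (drift_word n @ w) z \<subseteq> trace a b w z \<union> g_top \<union> drift ` h_top"
  using assms
proof (induction n)
  case (Suc n)
  let ?p = "(drift ^^ n) (run a b w z)"
  have "?p \<in> h_top" using Suc.prems[of n] by simp
  moreover have "b h ?p \<in> g_top" using h_top_step(1)[OF calculation h] .
  moreover have "a g (b h ?p) \<in> drift ` h_top" using calculation by (auto simp: drift_def)
  ultimately show ?case using Suc by auto
qed auto

text \<open>
  First \<open>F\<close> is moved off the finite cycles, then it drifts until all its points rise, and then it
  drifts beyond everything visited so far. The letter \<open>h'\<close> then branches off: what has been visited
  beyond that height lies in \<open>g_top\<close>, or was reached by a full step of the drift, and the point reached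
  by the final \<open>g\<close> is neither. This final letter is kept apart from \<open>u\<close> because the end point has
  to stay outside \<open>E\<close>, while the point before it belongs to the path.
\<close>

theorem escape:
  assumes "finite F"
  shows "\<exists>u \<in> words G H. \<exists>E. finite E \<and> {p. \<rho> p = 0} \<subseteq> E \<and>
           (\<forall>z \<in> F. trace a b u z \<subseteq> E \<and> a g (run a b u z) \<notin> E)"
proof -
  obtain w where w: "w \<in> words G H" "\<forall>z \<in> F. run a b w z \<notin> cyclic_points"
    using move_off_cyclic_points[OF assms] by blast
  obtain N where N: "\<And>n p. N \<le> n \<Longrightarrow> p \<in> run a b w ` F \<Longrightarrow>
      (drift ^^ n) p \<in> h_top \<and> 0 < \<rho> ((drift ^^ n) p)"
    using w(2) assms by (rule_tac eventually_deep_finite[of "run a b w ` F" 0]) auto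
  define w1 where "w1 = drift_word N @ w"
  define W where "W = {p. \<rho> p = 0} \<union> (\<Union>z \<in> F. trace a b w1 z)"
  have w1: "(drift ^^ n) (run a b w1 z) \<in> h_top" if "z \<in> F" for n z
    using N[of "n + N" "run a b w z"] that by (simp add: w1_def funpow_add)
  have "finite W" using assms finite_core by (auto simp: W_def)
  then obtain B where B: "\<And>q. q \<in> W \<Longrightarrow> \<rho> q \<le> B" by (rule finite_rank_bound) auto
  define n where "n = Suc B"
  \<comment> \<open>Each step of the drift raises the rank by at least one, hence more than \<open>B\<close> steps suffice.\<close>
  have deep: "(drift ^^ n) (run a b w1 z) \<in> h_top" "B < \<rho> ((drift ^^ n) (run a b w1 z))"
    if "z \<in> F" for z
    using h_top_drift_funpow[OF w1[OF that, of 0], of n] by (auto simp: n_def)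
  define u where "u = Inr h' # drift_word n @ w1"
  define E where "E = {p. \<rho> p = 0} \<union> (\<Union>z \<in> F. trace a b u z)"
  have "trace a b u z \<subseteq> W \<union> g_top \<union> drift ` h_top" if "z \<in> F" for z
  proof -
    have "trace a b (drift_word n @ w1) z \<subseteq> W \<union> g_top \<union> drift ` h_top"
      using trace_drift_word[of n w1 z] w1[OF that] that by (auto simp: W_def)
    moreover have "b h' ((drift ^^ n) (run a b w1 z)) \<in> g_top"
      using h_top_step(1)[OF deep(1)[OF that] h'(1,2)] .
    ultimately show ?thesis by (auto simp: u_def)
  qed
  then have E_sub: "E \<subseteq> W \<union> g_top \<union> drift ` h_top" by (auto simp: E_def W_def)
  have "a g (run a b u z) \<notin> E" if "z \<in> F" for z
  proof
    let ?p = "(drift ^^ n) (run a b w1 z)"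
    assume "a g (run a b u z) \<in> E"
    then have E: "a g (b h' ?p) \<in> W \<union> g_top \<union> drift ` h_top"
      using E_sub by (auto simp: u_def)
    note 1 = h_top_step[OF deep(1)[OF that] h'(1,2)]
    note 2 = g_top_step[OF 1(1) g]
    have "a g (b h' ?p) \<notin> W" using B 1(2) 2(2) deep(2)[OF that] by fastforce
    moreover have "a g (b h' ?p) \<notin> g_top" using 2(1) by (auto simp: h_top_def)
    ultimately obtain y where y: "y \<in> h_top" "a g (b h' ?p) = drift y" using E by auto
    \<comment> \<open>Then \<open>y\<close> lies in the \<open>H\<close>-orbit of \<open>?p\<close> and differs from it since \<open>h \<noteq> h'\<close>; but only one point
        of an \<open>H\<close>-orbit can be its minimum.\<close>
    then have "b h' ?p = b h y" using A.act_eq_iff[OF g(1)] by (auto simp: drift_def)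
    then have y_eq: "b (inv\<^bsub>H\<^esub> h \<otimes>\<^bsub>H\<^esub> h') ?p = y"
      using h h' by (intro B.act_eq_act)
    have "inv\<^bsub>H\<^esub> h \<otimes>\<^bsub>H\<^esub> h' \<noteq> \<one>\<^bsub>H\<^esub>"
      using h h' by (metis B.inv_closed B.inv_equality B.inv_inv)
    then have "y \<in> g_top"
      using h_top_step(1)[OF deep(1)[OF that], of "inv\<^bsub>H\<^esub> h \<otimes>\<^bsub>H\<^esub> h'"] y_eq h h' by auto
    with y(1) show False by (auto simp: h_top_def)
  qed
  moreover have "finite E" using assms finite_core by (auto simp: E_def)
  moreover have "u \<in> words G H" using w(1) h' by (auto simp: u_def w1_def)
  ultimately show ?thesis by (intro bexI[of _ u] exI[of _ E]) (auto simp: E_def)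
qed

end

section \<open>Extending finite partial injections\<close>

lemma limit_of_partial_injections:
  fixes f :: "nat \<Rightarrow> 'x \<Rightarrow> 'y" and E :: "nat \<Rightarrow> 'x set"
  assumes inj: "\<And>n. inj_on (f n) (E n)"
    and sub: "\<And>n. E n \<subseteq> E (Suc n)"
    and agree: "\<And>n p. p \<in> E n \<Longrightarrow> f (Suc n) p = f n p"
    and dom: "\<And>p. \<exists>n. p \<in> E n"
    and ran: "\<And>q. \<exists>n. q \<in> f n ` E n"
  shows "\<exists>\<tau>. bij \<tau> \<and> (\<forall>n. \<forall>p \<in> E n. \<tau> p = f n p)"
proof -
  have mono: "E m \<subseteq> E n" if "m \<le> n" for m n
    using lift_Suc_mono_le[of E, OF sub that] .
  have agree_le: "f n p = f m p" if "m \<le> n" "p \<in> E m" for m n p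
    using that(1)
  proof (induction n rule: dec_induct)
    case (step n)
    then show ?case using agree[of p n] mono[of m n] that(2) by auto
  qed simp
  define \<tau> where "\<tau> p = f (LEAST n. p \<in> E n) p" for p
  have \<tau>: "\<tau> p = f n p" if "p \<in> E n" for n p
    unfolding \<tau>_def using that by (metis LeastI Least_le agree_le)
  have "inj \<tau>"
  proof (rule injI)
    fix p q
    assume "\<tau> p = \<tau> q"
    obtain m n where "p \<in> E m" "q \<in> E n" using dom by blast
    then have "p \<in> E (max m n)" "q \<in> E (max m n)"
      using mono[of m "max m n"] mono[of n "max m n"] by auto
    with \<open>\<tau> p = \<tau> q\<close> show "p = q" using \<tau> inj[of "max m n"] by (metis inj_onD)
  qed
  moreover have "surj \<tau>"
  proof -
    have "\<exists>p. \<tau> p = q" for q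
      using ran[of q] \<tau> by blast
    then show ?thesis by (metis surjI)
  qed
  ultimately show ?thesis using \<tau> by (auto simp: bij_def)
qed

text \<open>
  The points \<open>base i\<close> lie in pairwise different orbits, so there are infinitely many orbits.
\<close>

locale spread_action = free_action G act
  for G (structure) and act :: "'a \<Rightarrow> nat \<Rightarrow> nat" +
  fixes base :: "nat \<Rightarrow> nat"
  assumes base: "g \<in> carrier G \<Longrightarrow> act g (base i) = base j \<Longrightarrow> i = j"
begin

text \<open>
  An element of \<open>R\<close> spoils at most one of the orbits through the points \<open>base i\<close>.
\<close>

lemma fresh_orbits:
  assumes "finite R"
  shows "\<exists>M. \<forall>i \<ge> M. \<forall>g \<in> carrier G. act g (base i) \<notin> R"
  using assms
proof (induction R)
  case (insert q R)
  then obtain M where M: "\<forall>i \<ge> M. \<forall>g \<in> carrier G. act g (base i) \<notin> R" by blast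
  show ?case
  proof (cases "\<exists>j. \<exists>k \<in> carrier G. act k (base j) = q")
    case True
    then obtain j k where k: "k \<in> carrier G" "act k (base j) = q" by blast
    have "act g (base i) \<noteq> q" if "g \<in> carrier G" "i > j" for g i
    proof
      assume "act g (base i) = q"
      then have "act (inv k \<otimes> g) (base i) = base j"
        using k that by (intro act_eq_act) auto
      with base[of "inv k \<otimes> g" i j] k that show False by simp
    qed
    with M show ?thesis by (intro exI[of _ "max M (Suc j)"]) auto
  next
    case False
    with M show ?thesis by (intro exI[of _ M]) auto
  qed
qed auto

end

locale spread_pair = A: spread_action G a s + B: spread_action H b t
  for G :: "('a, 'm) monoid_scheme" and H :: "('b, 'n) monoid_scheme"
    and a :: "'a \<Rightarrow> nat \<Rightarrow> nat" and b :: "'b \<Rightarrow> nat \<Rightarrow> nat" and s t :: "nat \<Rightarrow> nat"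
begin

lemma spread_pair_conj:
  "bij \<sigma> \<Longrightarrow> free_action_pair G H a (conj_act \<sigma> b)"
  by (intro free_action_pair.intro free_action_conj_act A.free_action_axioms B.free_action_axioms)

text \<open>
  At most one point is added per step, as the rank of the points is to be strictly minimal in orbits.
\<close>

definition fresh_step :: "(nat \<Rightarrow> nat) \<Rightarrow> nat set \<Rightarrow> (nat \<Rightarrow> nat) \<Rightarrow> nat set \<Rightarrow> bool" where
  "fresh_step f E f' E' \<longleftrightarrow> (\<forall>p \<in> E. f' p = f p) \<and>
     (E' = E \<or> (\<exists>p. p \<notin> E \<and> E' = insert p E \<and>
        ((\<forall>g \<in> carrier G. a g p \<notin> E) \<or> (\<forall>h \<in> carrier H. b h (f' p) \<notin> f ` E))))"

text \<open>
  The parity of \<open>n\<close> organises a back-and-forth construction: even stages put \<open>n div 2\<close> into the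
  domain, odd ones into the range.
\<close>

lemma fresh_step_exists:
  assumes "finite E" "inj_on f E"
  shows "\<exists>f' E'. finite E' \<and> inj_on f' E' \<and> fresh_step f E f' E' \<and>
           (if even n then n div 2 \<in> E' else n div 2 \<in> f' ` E')"
proof (cases "if even n then n div 2 \<in> E else n div 2 \<in> f ` E")
  case True
  with assms show ?thesis by (intro exI[of _ f] exI[of _ E]) (auto simp: fresh_step_def)
next
  case False
  show ?thesis
  proof (cases "even n")
    case True
    let ?p = "n div 2"
    have p: "?p \<notin> E" using False True by simp
    obtain M where M: "\<forall>h \<in> carrier H. b h (t M) \<notin> f ` E"
      using B.fresh_orbits[of "f ` E"] assms(1) by blast
    then have "t M \<notin> f ` E" using B.act_one by (metis B.one_closed)
    moreover have "(f(?p := t M)) ` E = f ` E" using p by auto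
    moreover have "inj_on (f(?p := t M)) E"
      using assms(2) p by (metis inj_on_cong fun_upd_other)
    ultimately have "inj_on (f(?p := t M)) (insert ?p E)" using p by simp
    moreover have "fresh_step f E (f(?p := t M)) (insert ?p E)"
      using M p by (auto simp: fresh_step_def)
    ultimately show ?thesis using assms True
      by (intro exI[of _ "f(?p := t M)"] exI[of _ "insert ?p E"]) auto
  next
    case odd: False
    let ?r = "n div 2"
    have r: "?r \<notin> f ` E" using False odd by simp
    obtain M where M: "\<forall>g \<in> carrier G. a g (s M) \<notin> E"
      using A.fresh_orbits[OF assms(1)] by blast
    then have p: "s M \<notin> E" using A.act_one by (metis A.one_closed)
    then have "(f(s M := ?r)) ` E = f ` E" by auto
    moreover have "inj_on (f(s M := ?r)) E"
      using assms(2) p by (metis inj_on_cong fun_upd_other)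
    ultimately have "inj_on (f(s M := ?r)) (insert (s M) E)" using p r by simp
    moreover have "fresh_step f E (f(s M := ?r)) (insert (s M) E)"
      using M p by (auto simp: fresh_step_def)
    ultimately show ?thesis using assms odd
      by (intro exI[of _ "f(s M := ?r)"] exI[of _ "insert (s M) E"]) auto
  qed
qed

text \<open>
  When a point enters the domain at a stage where its \<open>G\<close>-orbit is fresh, the other points of this
  orbit have to enter later; likewise for the \<open>H\<close>-orbit of its image.
\<close>

theorem ranked_extension:
  assumes "finite E" "inj_on f E"
  shows "\<exists>\<sigma> \<rho>. bij \<sigma> \<and> (\<forall>p \<in> E. \<sigma> p = f p) \<and> {p. \<rho> p = 0} = E \<and>
           ranked_pair G H a (conj_act \<sigma> b) \<rho>"
proof -
  define P where "P c \<longleftrightarrow> finite (snd c) \<and> inj_on (fst c) (snd c)"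
    for c :: "(nat \<Rightarrow> nat) \<times> nat set"
  define Q where "Q n c c' \<longleftrightarrow> fresh_step (fst c) (snd c) (fst c') (snd c') \<and>
      (if even n then n div 2 \<in> snd c' else n div 2 \<in> fst c' ` snd c')"
    for n and c c' :: "(nat \<Rightarrow> nat) \<times> nat set"
  have "\<exists>c. \<forall>n. (P (c n) \<and> (n = 0 \<longrightarrow> c n = (f, E))) \<and> Q n (c n) (c (Suc n))"
  proof (rule dependent_nat_choice)
    show "\<exists>c. P c \<and> (0 = 0 \<longrightarrow> c = (f, E))"
      using assms by (auto simp: P_def)
    show "\<exists>c'. (P c' \<and> (Suc n = 0 \<longrightarrow> c' = (f, E))) \<and> Q n c c'"
      if c: "P c \<and> (n = 0 \<longrightarrow> c = (f, E))" for c n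
    proof -
      obtain f' E' where "finite E'" "inj_on f' E'" "fresh_step (fst c) (snd c) f' E'"
        "if even n then n div 2 \<in> E' else n div 2 \<in> f' ` E'"
        using fresh_step_exists[of "snd c" "fst c" n] c by (auto simp: P_def)
      then show ?thesis by (intro exI[of _ "(f', E')"]) (simp add: P_def Q_def)
    qed
  qed
  then obtain c where c: "\<And>n. P (c n)" "c 0 = (f, E)" "\<And>n. Q n (c n) (c (Suc n))" by blast
  define F where "F n = fst (c n)" for n
  define D where "D n = snd (c n)" for n
  have 0: "F 0 = f" "D 0 = E" using c(2) by (auto simp: F_def D_def)
  have step: "fresh_step (F n) (D n) (F (Suc n)) (D (Suc n))" for n
    using c(3) by (auto simp: Q_def F_def D_def)
  have dom: "m \<in> D (Suc (2 * m))" for m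
    using c(3)[of "2 * m"] by (auto simp: Q_def D_def)
  have ran: "m \<in> F (Suc (2 * m + 1)) ` D (Suc (2 * m + 1))" for m
    using c(3)[of "2 * m + 1"] by (auto simp: Q_def F_def D_def)
  have sub: "D n \<subseteq> D (Suc n)" for n
    using step[of n] by (auto simp: fresh_step_def)
  have mono: "D m \<subseteq> D n" if "m \<le> n" for m n
    using lift_Suc_mono_le[of D, OF sub that] .
  have "\<exists>\<sigma>. bij \<sigma> \<and> (\<forall>n. \<forall>p \<in> D n. \<sigma> p = F n p)"
  proof (rule limit_of_partial_injections)
    show "inj_on (F n) (D n)" for n using c(1) by (auto simp: P_def F_def D_def)
    show "F (Suc n) p = F n p" if "p \<in> D n" for n p
      using step[of n] that by (auto simp: fresh_step_def)
  qed (use dom ran sub in blast)+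
  then obtain \<sigma> where \<sigma>: "bij \<sigma>" "\<And>n p. p \<in> D n \<Longrightarrow> \<sigma> p = F n p" by blast
  define \<rho> where "\<rho> p = (LEAST n. p \<in> D n)" for p
  have \<rho>: "p \<in> D (\<rho> p)" for p
    unfolding \<rho>_def using dom by (rule LeastI)
  have \<rho>_le: "\<rho> p \<le> n \<longleftrightarrow> p \<in> D n" for p n
    using \<rho>[of p] mono[of "\<rho> p" n] by (auto simp: \<rho>_def intro: Least_le)
  have core: "{p. \<rho> p = 0} = E"
    using \<rho>_le[of _ 0] 0 by auto
  interpret free_action_pair G H a "conj_act \<sigma> b" by (rule spread_pair_conj) (rule \<sigma>(1))
  have "ranked_pair G H a (conj_act \<sigma> b) \<rho>"
  proof unfold_locales
    show "finite {p. \<rho> p = 0}" using core assms(1) by simp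
    fix p
    assume "\<rho> p > 0"
    then obtain n where n: "\<rho> p = Suc n" by (cases "\<rho> p") auto
    then have p: "p \<notin> D n" "p \<in> D (Suc n)" using \<rho>_le[of p n] \<rho>_le[of p "Suc n"] by simp_all
    with step[of n] have D: "D (Suc n) = insert p (D n)"
      and fresh: "(\<forall>g \<in> carrier G. a g p \<notin> D n) \<or> (\<forall>h \<in> carrier H. b h (F (Suc n) p) \<notin> F n ` D n)"
      by (auto simp: fresh_step_def)
    have lt: "\<rho> p < \<rho> q" if "q \<noteq> p" "q \<notin> D n" for q
      using \<rho>_le[of q "Suc n"] that D n by auto
    from fresh show "(\<forall>g \<in> carrier G - {\<one>\<^bsub>G\<^esub>}. \<rho> p < \<rho> (a g p)) \<or>
        (\<forall>h \<in> carrier H - {\<one>\<^bsub>H\<^esub>}. \<rho> p < \<rho> (conj_act \<sigma> b h p))"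
    proof
      assume "\<forall>g \<in> carrier G. a g p \<notin> D n"
      then have "\<forall>g \<in> carrier G - {\<one>\<^bsub>G\<^esub>}. \<rho> p < \<rho> (a g p)"
        using A.act_free by (intro ballI lt) auto
      then show ?thesis ..
    next
      assume *: "\<forall>h \<in> carrier H. b h (F (Suc n) p) \<notin> F n ` D n"
      have "conj_act \<sigma> b h p \<notin> D n" if "h \<in> carrier H" for h
      proof
        assume "conj_act \<sigma> b h p \<in> D n"
        then have "\<sigma> (conj_act \<sigma> b h p) \<in> F n ` D n" using \<sigma>(2) by auto
        then show False using * that \<sigma>(2)[OF p(2)] by (simp add: conj_act_apply[OF \<sigma>(1)])
      qed
      moreover have "conj_act \<sigma> b h p \<noteq> p" if "h \<in> carrier H - {\<one>\<^bsub>H\<^esub>}" for h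
        using that B.act_free by auto
      ultimately have "\<forall>h \<in> carrier H - {\<one>\<^bsub>H\<^esub>}. \<rho> p < \<rho> (conj_act \<sigma> b h p)"
        using lt by blast
      then show ?thesis ..
    qed
  qed
  then show ?thesis using \<sigma> 0 core by blast
qed

end

section \<open>Open injections and forcing\<close>

context spread_pair
begin

text \<open>
  A nonempty set \<open>S\<close> violating the last clause would be a finite union of orbits of the free product
  for every bijection that extends the values of \<open>f\<close> on \<open>E\<close>.
\<close>

definition open_injection :: "(nat \<Rightarrow> nat) \<Rightarrow> nat set \<Rightarrow> bool" where
  "open_injection f E \<longleftrightarrow> finite E \<and> inj_on f E \<and>
     (\<forall>S \<subseteq> E. (\<forall>p \<in> S. (\<forall>g \<in> carrier G. a g p \<in> S) \<and>
        (\<forall>h \<in> carrier H. \<exists>q \<in> S. f q = b h (f p))) \<longrightarrow> S = {})"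

lemma open_injectionD:
  assumes "open_injection f E"
  shows "finite E" "inj_on f E"
    and "S \<subseteq> E \<Longrightarrow> (\<And>p g. p \<in> S \<Longrightarrow> g \<in> carrier G \<Longrightarrow> a g p \<in> S) \<Longrightarrow>
      (\<And>p h. p \<in> S \<Longrightarrow> h \<in> carrier H \<Longrightarrow> \<exists>q \<in> S. f q = b h (f p)) \<Longrightarrow> S = {}"
  using assms by (auto simp: open_injection_def)

lemma open_injection_empty: "open_injection f {}"
  by (simp add: open_injection_def)

text \<open>
  An orbit inside the core would be an invariant set of the kind that openness excludes.
\<close>

lemma ranked_leaves_core:
  assumes "open_injection f E" "bij \<sigma>" "\<forall>p \<in> E. \<sigma> p = f p" "{p. \<rho> p = (0::nat)} = E"
  shows "\<exists>v \<in> words G H. \<rho> (run a (conj_act \<sigma> b) v p) > 0"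
proof (rule ccontr)
  let ?S = "(\<lambda>v. run a (conj_act \<sigma> b) v p) ` words G H"
  assume "\<not> ?thesis"
  then have sub: "?S \<subseteq> E" using assms(4) by auto
  have "?S = {}"
  proof (rule open_injectionD(3)[OF assms(1) sub])
    fix q g
    assume "q \<in> ?S" "g \<in> carrier G"
    then show "a g q \<in> ?S" by (force intro: image_eqI[where x = "Inl g # _"])
  next
    fix q h
    assume q: "q \<in> ?S" and h: "h \<in> carrier H"
    then have in_S: "conj_act \<sigma> b h q \<in> ?S" by (force intro: image_eqI[where x = "Inr h # _"])
    then have "f (conj_act \<sigma> b h q) = b h (f q)"
      using sub q assms(3) conj_act_apply[OF assms(2), of b h q] by (metis subsetD)
    with in_S show "\<exists>q' \<in> ?S. f q' = b h (f q)" by blast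
  qed
  then show False using words_simps(1) by blast
qed

text \<open>
  A finite invariant set has a point of maximal rank. This point is not the strict minimum of a
  nontrivial orbit, and so all ranks vanish: the set is contained in the core, which is open.
\<close>

lemma ranked_open_injection:
  assumes "open_injection f E" "bij \<sigma>" "\<forall>p \<in> E. \<sigma> p = f p" "{p. \<rho> p = (0::nat)} = E"
    and "ranked_pair G H a (conj_act \<sigma> b) \<rho>" "carrier G \<noteq> {\<one>\<^bsub>G\<^esub>}" "carrier H \<noteq> {\<one>\<^bsub>H\<^esub>}"
    and "finite E'"
  shows "open_injection \<sigma> E'"
  unfolding open_injection_def
proof (intro conjI allI impI)
  show "finite E'" by fact
  show "inj_on \<sigma> E'" using assms(2) by (meson bij_is_inj inj_on_subset subset_UNIV)
  fix S
  assume S: "S \<subseteq> E'" and inv: "\<forall>p \<in> S. (\<forall>g \<in> carrier G. a g p \<in> S) \<and>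
        (\<forall>h \<in> carrier H. \<exists>q \<in> S. \<sigma> q = b h (\<sigma> p))"
  interpret R: ranked_pair G H a "conj_act \<sigma> b" \<rho> by fact
  have invH: "conj_act \<sigma> b h p \<in> S" if "p \<in> S" "h \<in> carrier H" for h p
    using inv that conj_act_eqI[OF assms(2)] by metis
  have "\<rho> p = 0" if "p \<in> S" for p
  proof -
    have fin: "finite (\<rho> ` S)" using S assms(8) by (auto intro: finite_subset)
    moreover have "\<rho> ` S \<noteq> {}" using that by auto
    ultimately obtain m where m: "m \<in> S" "\<rho> m = Max (\<rho> ` S)" by (metis Max_in imageE)
    then have max: "\<rho> q \<le> \<rho> m" if "q \<in> S" for q using that fin by auto
    obtain g where g: "g \<in> carrier G - {\<one>\<^bsub>G\<^esub>}" using assms(6) A.one_closed by blast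
    obtain h where h: "h \<in> carrier H - {\<one>\<^bsub>H\<^esub>}" using assms(7) B.one_closed by blast
    have "a g m \<in> S" "conj_act \<sigma> b h m \<in> S" using inv invH m(1) g h by auto
    then have "\<rho> m = 0" using R.strict_min[of m] max g h by (meson gr0I leD)
    with max[OF that] show ?thesis by simp
  qed
  then have "S \<subseteq> E" using assms(4) by auto
  then show "S = {}"
  proof (rule open_injectionD(3)[OF assms(1)])
    fix p h
    assume "p \<in> S" "h \<in> carrier H"
    then obtain q where "q \<in> S" "\<sigma> q = b h (\<sigma> p)" using inv by blast
    then show "\<exists>q \<in> S. f q = b h (f p)"
      using \<open>S \<subseteq> E\<close> \<open>p \<in> S\<close> assms(3) by (metis subsetD)
  qed (use inv in auto)
qed

text \<open>
  The values at \<open>A\<close> and \<open>k ` A\<close> are taken as \<open>r p\<close> and \<open>h r p\<close>, with the points \<open>r p\<close> in distinct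
  fresh orbits. As \<open>h' r p\<close> remains outside the range, an invariant set cannot meet the added points.
\<close>

lemma glue:
  assumes "open_injection \<sigma> E" "finite A" "A \<inter> E = {}" "inj_on k A" "k ` A \<inter> (A \<union> E) = {}"
    and h: "h \<in> carrier H" "h \<noteq> \<one>\<^bsub>H\<^esub>" and h': "h' \<in> carrier H" "h' \<noteq> \<one>\<^bsub>H\<^esub>" "h \<noteq> h'"
  shows "\<exists>f. open_injection f (E \<union> A \<union> k ` A) \<and> (\<forall>p \<in> E. f p = \<sigma> p) \<and>
           (\<forall>p \<in> A. f (k p) = b h (f p))"
proof -
  have finE: "finite E" and injE: "inj_on \<sigma> E" using open_injectionD[OF assms(1)] by auto
  obtain M where M: "\<forall>i \<ge> M. \<forall>g \<in> carrier H. b g (t i) \<notin> \<sigma> ` E"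
    using B.fresh_orbits[of "\<sigma> ` E"] finE by blast
  define r where "r p = t (M + p)" for p
  have r_fresh: "b g (r p) \<noteq> \<sigma> q" if "g \<in> carrier H" "q \<in> E" for g p q
    using M[rule_format, of "M + p" g] that by (auto simp: r_def)
  have r_eq: "p = q \<and> g = g'" if "g \<in> carrier H" "g' \<in> carrier H" "b g (r p) = b g' (r q)" for g g' p q
  proof -
    have "b (inv\<^bsub>H\<^esub> g' \<otimes>\<^bsub>H\<^esub> g) (r p) = r q" using that by (intro B.act_eq_act)
    then have "p = q" using B.base[of "inv\<^bsub>H\<^esub> g' \<otimes>\<^bsub>H\<^esub> g" "M + p" "M + q"] that by (auto simp: r_def)
    with that show ?thesis using B.act_left_cancel by auto
  qed
  define f where "f p = (if p \<in> E then \<sigma> p else if p \<in> A then r p else b h (r (inv_into A k p)))" for p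
  have fE: "f p = \<sigma> p" if "p \<in> E" for p using that by (simp add: f_def)
  have fA: "f p = b \<one>\<^bsub>H\<^esub> (r p)" if "p \<in> A" for p using that assms(3) by (auto simp: f_def)
  have fk: "f (k p) = b h (r p)" if "p \<in> A" for p
    using that assms(4,5) by (auto simp: f_def)
  \<comment> \<open>Writing the value \<open>r p\<close> as \<open>\<one> r p\<close> puts all three cases into the form that \<open>r_eq\<close> and
      \<open>r_fresh\<close> handle.\<close>
  have f_cases: "(p \<in> E \<and> f p = \<sigma> p) \<or> (\<exists>q \<in> A. p = q \<and> f p = b \<one>\<^bsub>H\<^esub> (r q)) \<or>
      (\<exists>q \<in> A. p = k q \<and> f p = b h (r q))"
    if "p \<in> E \<union> A \<union> k ` A" for p
    using that fE fA fk by blast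
  have "inj_on f (E \<union> A \<union> k ` A)"
  proof (rule inj_onI)
    fix p q
    assume "p \<in> E \<union> A \<union> k ` A" "q \<in> E \<union> A \<union> k ` A" and eq: "f p = f q"
    from f_cases[OF this(1)] f_cases[OF this(2)] show "p = q"
      using eq r_fresh r_eq h injE B.one_closed by (metis inj_onD)
  qed
  moreover have hole: "f p \<noteq> b h' (r q)" if "p \<in> E \<union> A \<union> k ` A" for p q
    using f_cases[OF that] r_fresh r_eq h h' B.one_closed by metis
  have "S = {}" if S: "S \<subseteq> E \<union> A \<union> k ` A"
    and inv: "\<forall>p \<in> S. (\<forall>g \<in> carrier G. a g p \<in> S) \<and> (\<forall>h \<in> carrier H. \<exists>q \<in> S. f q = b h (f p))" for S
  proof -
    have "f p \<noteq> b g (r q)" if p: "p \<in> S" and g: "g \<in> carrier H" for p q g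
    proof
      assume "f p = b g (r q)"
      then have "b (h' \<otimes>\<^bsub>H\<^esub> inv\<^bsub>H\<^esub> g) (f p) = b h' (r q)"
        using g h' by (simp add: B.act_mult)
      moreover have "\<exists>p' \<in> S. f p' = b (h' \<otimes>\<^bsub>H\<^esub> inv\<^bsub>H\<^esub> g) (f p)"
        using inv p g h' by simp
      ultimately show False using hole S by (metis subsetD)
    qed
    then have "S \<subseteq> E" using f_cases S h B.one_closed by (metis subsetD subsetI)
    then show "S = {}"
    proof (rule open_injectionD(3)[OF assms(1)])
      fix p h
      assume "p \<in> S" "h \<in> carrier H"
      then obtain q where "q \<in> S" "f q = b h (f p)" using inv by blast
      then show "\<exists>q \<in> S. \<sigma> q = b h (\<sigma> p)"
        using \<open>S \<subseteq> E\<close> \<open>p \<in> S\<close> fE by (metis subsetD)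
    qed (use inv in auto)
  qed
  ultimately have "open_injection f (E \<union> A \<union> k ` A)"
    using finE assms(2) by (auto simp: open_injection_def)
  moreover have "f (k p) = b h (f p)" if "p \<in> A" for p
    using fk fA that by simp
  ultimately show ?thesis using fE by blast
qed

definition forces :: "(nat \<Rightarrow> nat) \<Rightarrow> nat set \<Rightarrow> ((nat \<Rightarrow> nat) \<Rightarrow> bool) \<Rightarrow> bool" where
  "forces f E R \<longleftrightarrow> (\<forall>\<tau>. bij \<tau> \<longrightarrow> (\<forall>p \<in> E. \<tau> p = f p) \<longrightarrow> R \<tau>)"

definition dense :: "((nat \<Rightarrow> nat) \<Rightarrow> bool) \<Rightarrow> bool" where
  "dense R \<longleftrightarrow> (\<forall>f E. open_injection f E \<longrightarrow>
     (\<exists>f' E'. open_injection f' E' \<and> E \<subseteq> E' \<and> (\<forall>p \<in> E. f' p = f p) \<and> forces f' E' R))"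

end

locale large_spread_pair = spread_pair +
  fixes g h h'
  assumes g: "g \<in> carrier G" "g \<noteq> \<one>\<^bsub>G\<^esub>"
    and h: "h \<in> carrier H" "h \<noteq> \<one>\<^bsub>H\<^esub>"
    and h': "h' \<in> carrier H" "h' \<noteq> \<one>\<^bsub>H\<^esub>" "h \<noteq> h'"
begin

lemma escaping_extension:
  assumes "open_injection f E"
  obtains \<sigma> \<rho> where "bij \<sigma>" "\<forall>p \<in> E. \<sigma> p = f p" "{p. \<rho> p = 0} = E"
    "escaping_pair G H a (conj_act \<sigma> b) \<rho> g h h'"
    "\<And>E'. finite E' \<Longrightarrow> open_injection \<sigma> E'"
proof -
  obtain \<sigma> \<rho> where \<sigma>: "bij \<sigma>" "\<forall>p \<in> E. \<sigma> p = f p" "{p. \<rho> p = 0} = E"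
    and ranked: "ranked_pair G H a (conj_act \<sigma> b) \<rho>"
    using ranked_extension open_injectionD[OF assms] by metis
  have "escaping_pair G H a (conj_act \<sigma> b) \<rho> g h h'"
    using g h h' ranked_leaves_core[OF assms \<sigma>]
    by (intro escaping_pair.intro ranked escaping_pair_axioms.intro)
  moreover have "open_injection \<sigma> E'" if "finite E'" for E'
    using g h by (intro ranked_open_injection[OF assms \<sigma> ranked _ _ that]) auto
  ultimately show ?thesis using \<sigma> that by blast
qed

lemma dense_total: "dense (\<lambda>_. True)"
  by (auto simp: dense_def forces_def)

text \<open>
  In a ranked completion the word raises the rank of a suitable point, and its path there uses only
  finitely many values of the bijection.
\<close>

lemma dense_moves:
  assumes w: "w \<in> reduced_words G H" "w \<noteq> []"
  shows "dense (\<lambda>\<tau>. \<exists>x. run a (conj_act \<tau> b) w x \<noteq> x)"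
  unfolding dense_def
proof (intro allI impI)
  fix f E
  assume open_inj: "open_injection f E"
  obtain \<sigma> \<rho> where \<sigma>: "bij \<sigma>" "\<forall>p \<in> E. \<sigma> p = f p" "{p. \<rho> p = 0} = E"
    and "escaping_pair G H a (conj_act \<sigma> b) \<rho> g h h'"
    and ext: "\<And>E'. finite E' \<Longrightarrow> open_injection \<sigma> E'"
    using escaping_extension[OF open_inj] by metis
  then interpret R: escaping_pair G H a "conj_act \<sigma> b" \<rho> g h h' by simp
  obtain p where "\<rho> p > 0" using R.leaves_core by blast
  then obtain x where x: "if isl (last w) then x \<in> R.g_top else x \<in> R.h_top"
    using R.rank_pos_cases[of p] R.g_top_step(1)[OF _ g] R.h_top_step(1)[OF _ h] by (metis (full_types))
  define E' where "E' = E \<union> trace a (conj_act \<sigma> b) w x"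
  have "finite E'" using open_injectionD(1)[OF open_inj] by (simp add: E'_def)
  have "run a (conj_act \<sigma> b) w x \<noteq> x"
    using R.run_reduced_increases[OF w x] by auto
  then have "forces \<sigma> E' (\<lambda>\<tau>. \<exists>x. run a (conj_act \<tau> b) w x \<noteq> x)"
    unfolding forces_def E'_def
    by (intro allI impI exI[of _ x]) (simp add: run_conj_act_cong[OF \<sigma>(1)])
  then show "\<exists>f' E'. open_injection f' E' \<and> E \<subseteq> E' \<and> (\<forall>p \<in> E. f' p = f p) \<and>
      forces f' E' (\<lambda>\<tau>. \<exists>x. run a (conj_act \<tau> b) w x \<noteq> x)"
    using \<sigma>(2) ext[OF \<open>finite E'\<close>] by (intro exI[of _ \<sigma>] exI[of _ E']) (auto simp: E'_def)
qed

text \<open>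
  With \<open>e\<close> the map given by the escaping word, \<open>k\<close> is the injection \<open>\<pi>\<close> seen at the end points.
  Gluing makes \<open>h\<close> realise \<open>k\<close> on them, and thus the conjugate of \<open>h\<close> by \<open>e\<close> realises \<open>\<pi>\<close>.
\<close>

lemma dense_transports:
  fixes \<pi> :: "nat \<Rightarrow> nat"
  assumes X: "finite X" "inj_on \<pi> X" "\<pi> ` X \<inter> X = {}"
  shows "dense (\<lambda>\<tau>. \<exists>w \<in> words G H. \<forall>x \<in> X. run a (conj_act \<tau> b) w x = \<pi> x)"
  unfolding dense_def
proof (intro allI impI)
  fix f E
  assume open_inj: "open_injection f E"
  obtain \<sigma> \<rho> where \<sigma>: "bij \<sigma>" "\<forall>p \<in> E. \<sigma> p = f p" "{p. \<rho> p = 0} = E"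
    and "escaping_pair G H a (conj_act \<sigma> b) \<rho> g h h'"
    and ext: "\<And>E'. finite E' \<Longrightarrow> open_injection \<sigma> E'"
    using escaping_extension[OF open_inj] by metis
  then interpret R: escaping_pair G H a "conj_act \<sigma> b" \<rho> g h h' by simp
  obtain u E' where u: "u \<in> words G H" and E': "finite E'" "E \<subseteq> E'"
    and esc: "\<And>z. z \<in> X \<union> \<pi> ` X \<Longrightarrow> trace a (conj_act \<sigma> b) u z \<subseteq> E' \<and>
        a g (run a (conj_act \<sigma> b) u z) \<notin> E'"
    using R.escape[of "X \<union> \<pi> ` X"] X(1) \<sigma>(3) by auto
  define e where "e z = run a (conj_act \<sigma> b) (Inl g # u) z" for z
  have "Inl g # u \<in> words G H" using u g by simp
  then have inj_e: "inj e" unfolding e_def by (rule R.inj_run)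
  define k where "k = e \<circ> \<pi> \<circ> inv_into UNIV e"
  have k_e: "k (e z) = e (\<pi> z)" for z using inj_e by (simp add: k_def)
  obtain f' where f': "open_injection f' (E' \<union> e ` X \<union> k ` e ` X)" "\<forall>p \<in> E'. f' p = \<sigma> p"
      "\<forall>p \<in> e ` X. f' (k p) = b h (f' p)"
  proof (rule exE[OF glue[OF ext[OF E'(1)], of "e ` X" k h h']])
    show "finite (e ` X)" using X(1) by simp
    show "e ` X \<inter> E' = {}" using esc by (auto simp: e_def)
    show "inj_on k (e ` X)"
      using X(2) inj_e by (auto simp: inj_on_def k_e)
    show "k ` e ` X \<inter> (e ` X \<union> E') = {}"
      using X(3) esc inj_e by (auto simp: k_e inj_eq) (auto simp: e_def)
  qed (use h h' in auto)
  have "forces f' (E' \<union> e ` X \<union> k ` e ` X)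
      (\<lambda>\<tau>. \<exists>w \<in> words G H. \<forall>x \<in> X. run a (conj_act \<tau> b) w x = \<pi> x)"
    unfolding forces_def
  proof (intro allI impI)
    fix \<tau> :: "nat \<Rightarrow> nat"
    assume \<tau>: "bij \<tau>" and ag: "\<forall>p \<in> E' \<union> e ` X \<union> k ` e ` X. \<tau> p = f' p"
    interpret T: free_action_pair G H a "conj_act \<tau> b" by (rule spread_pair_conj) (rule \<tau>)
    have same: "run a (conj_act \<tau> b) (Inl g # u) z = e z" if "z \<in> X \<union> \<pi> ` X" for z
    proof -
      have "run a (conj_act \<tau> b) u z = run a (conj_act \<sigma> b) u z"
        using esc[OF that] ag f'(2) by (intro run_conj_act_cong \<sigma>(1) \<tau>) auto
      then show ?thesis by (simp add: e_def)
    qed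
    obtain v where v: "v \<in> words G H"
      "\<And>x. run a (conj_act \<tau> b) v (run a (conj_act \<tau> b) (Inl g # u) x) = x"
      using T.inverse_word[of "Inl g # u"] u g by auto
    have "run a (conj_act \<tau> b) (v @ Inr h # Inl g # u) x = \<pi> x" if x: "x \<in> X" for x
    proof -
      have "\<tau> (e (\<pi> x)) = b h (\<tau> (e x))" using ag f'(3) x by (auto simp flip: k_e)
      then have "conj_act \<tau> b h (e x) = e (\<pi> x)" by (intro conj_act_eqI \<tau>)
      then have "conj_act \<tau> b h (run a (conj_act \<tau> b) (Inl g # u) x)
          = run a (conj_act \<tau> b) (Inl g # u) (\<pi> x)"
        using same x by simp
      then show ?thesis using v(2)[of "\<pi> x"] by (metis run_simps(3,4))
    qed
    moreover have "v @ Inr h # Inl g # u \<in> words G H" using v(1) u g h by simp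
    ultimately show "\<exists>w \<in> words G H. \<forall>x \<in> X. run a (conj_act \<tau> b) w x = \<pi> x" by blast
  qed
  then show "\<exists>f' E'. open_injection f' E' \<and> E \<subseteq> E' \<and> (\<forall>p \<in> E. f' p = f p) \<and>
      forces f' E' (\<lambda>\<tau>. \<exists>w \<in> words G H. \<forall>x \<in> X. run a (conj_act \<tau> b) w x = \<pi> x)"
    using f'(1,2) E'(2) \<sigma>(2)
    by (intro exI[of _ f'] exI[of _ "E' \<union> e ` X \<union> k ` e ` X"]) auto
qed

text \<open>
  A Rasiowa--Sikorski argument; besides meeting the requirements, stage \<open>n\<close> puts \<open>n\<close> into the domain
  and the range, so that the limit is a bijection.
\<close>

lemma generic_bijection:
  assumes "countable \<R>" "\<And>R. R \<in> \<R> \<Longrightarrow> dense R"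
  shows "\<exists>\<tau>. bij \<tau> \<and> (\<forall>R \<in> \<R>. R \<tau>)"
proof -
  \<comment> \<open>The trivial requirement makes the family nonempty, as the enumeration needs.\<close>
  define \<R>' where "\<R>' = insert (\<lambda>_. True) \<R>"
  define R where "R = from_nat_into \<R>'"
  have R: "range R = \<R>'" using assms(1) by (simp add: R_def \<R>'_def range_from_nat_into)
  have dense: "dense (R n)" for n
  proof -
    have "R n \<in> insert (\<lambda>_. True) \<R>" using R by (auto simp: \<R>'_def)
    then show ?thesis using assms(2) dense_total by auto
  qed
  define P where "P c \<longleftrightarrow> open_injection (fst c) (snd c)" for c :: "(nat \<Rightarrow> nat) \<times> nat set"
  define Q where "Q n c c' \<longleftrightarrow> snd c \<subseteq> snd c' \<and> (\<forall>p \<in> snd c. fst c' p = fst c p) \<and>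
      n \<in> snd c' \<and> n \<in> fst c' ` snd c' \<and> forces (fst c') (snd c') (R n)"
    for n and c c' :: "(nat \<Rightarrow> nat) \<times> nat set"
  have "\<exists>c. \<forall>n. P (c n) \<and> Q n (c n) (c (Suc n))"
  proof (rule dependent_nat_choice)
    show "\<exists>c. P c" using open_injection_empty by (auto simp: P_def)
    fix c n
    assume "P c"
    then obtain f E where f: "open_injection f E" "snd c \<subseteq> E" "\<forall>p \<in> snd c. f p = fst c p"
        "forces f E (R n)"
      using dense[of n] unfolding dense_def P_def by metis
    obtain \<sigma> where \<sigma>: "bij \<sigma>" "\<forall>p \<in> E. \<sigma> p = f p" "\<And>E'. finite E' \<Longrightarrow> open_injection \<sigma> E'"
      using escaping_extension[OF f(1)] by metis
    define E' where "E' = E \<union> {n, inv_into UNIV \<sigma> n}"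
    have "open_injection \<sigma> E'"
      using open_injectionD(1)[OF f(1)] by (intro \<sigma>(3)) (simp add: E'_def)
    moreover have "forces \<sigma> E' (R n)" using f(4) \<sigma>(2) by (auto simp: forces_def E'_def)
    moreover have "\<sigma> (inv_into UNIV \<sigma> n) = n" using \<sigma>(1) by (simp add: bij_is_surj surj_f_inv_f)
    then have "n \<in> \<sigma> ` E'" by (force simp: E'_def)
    ultimately show "\<exists>c'. P c' \<and> Q n c c'"
      using f(2,3) \<sigma>(2) by (intro exI[of _ "(\<sigma>, E')"]) (auto simp: P_def Q_def E'_def)
  qed
  then obtain c where c: "\<And>n. P (c n)" "\<And>n. Q n (c n) (c (Suc n))" by blast
  have "\<exists>\<tau>. bij \<tau> \<and> (\<forall>n. \<forall>p \<in> snd (c n). \<tau> p = fst (c n) p)"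
  proof (rule limit_of_partial_injections)
    show "inj_on (fst (c n)) (snd (c n))" for n
      using c(1)[of n] open_injectionD by (auto simp: P_def)
    show "fst (c (Suc n)) p = fst (c n) p" if "p \<in> snd (c n)" for n p
      using c(2)[of n] that by (auto simp: Q_def)
  qed (use c(2) in \<open>unfold Q_def, blast\<close>)+
  then obtain \<tau> where \<tau>: "bij \<tau>" "\<And>n p. p \<in> snd (c n) \<Longrightarrow> \<tau> p = fst (c n) p" by blast
  have "R n \<tau>" for n
    using c(2)[of n] \<tau> unfolding Q_def forces_def by metis
  then have "\<forall>R' \<in> range R. R' \<tau>" by auto
  then show ?thesis using \<tau>(1) R by (auto simp: \<R>'_def)
qed

end

section \<open>A faithful and highly transitive pair of actions\<close>

text \<open>
  Left multiplication on the second component of \<open>\<nat> \<times> G\<close>, transported to \<open>\<nat>\<close>.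
\<close>

lemma (in group) spread_action_exists:
  assumes "countable (carrier G)"
  shows "\<exists>act base. spread_action G act base"
proof -
  define S where "S = (UNIV :: nat set) \<times> carrier G"
  have "infinite S"
    using one_closed unfolding S_def by (metis empty_iff finite_cartesian_productD1 infinite_UNIV_nat)
  moreover have "countable S" using assms by (simp add: S_def)
  ultimately obtain e :: "nat \<times> 'a \<Rightarrow> nat" where e: "bij_betw e S UNIV"
    by (metis countableE_infinite)
  define d where "d = inv_into S e"
  have d_e: "d (e z) = z" if "z \<in> S" for z
    using that e by (simp add: d_def bij_betw_inv_into_left)
  have e_d: "e (d n) = n" "d n \<in> S" for n
    using e by (auto simp: d_def bij_betw_inv_into_right bij_betw_def inv_into_into)
  have e_eq: "e y = e z \<longleftrightarrow> y = z" if "y \<in> S" "z \<in> S" for y z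
    using that d_e by metis
  define act where "act g n = e (fst (d n), g \<otimes> snd (d n))" for g n
  have snd_d: "snd (d n) \<in> carrier G" for n
    using e_d(2)[of n] by (auto simp: S_def)
  have S: "(i, g) \<in> S \<longleftrightarrow> g \<in> carrier G" for i g by (simp add: S_def)
  have "spread_action G act (\<lambda>i. e (i, \<one>))"
  proof unfold_locales
    fix x
    show "act \<one> x = x" using snd_d[of x] e_d(1) by (simp add: act_def)
    show "act (g \<otimes> k) x = act g (act k x)" if "g \<in> carrier G" "k \<in> carrier G" for g k
      using that snd_d[of x] by (simp add: act_def d_e S m_assoc)
    show "g = \<one>" if g: "g \<in> carrier G" and "act g x = x" for g
    proof -
      have "(fst (d x), g \<otimes> snd (d x)) = d x"
        using that snd_d[of x] e_d[of x] d_e S unfolding act_def by (metis m_closed)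
      then have "g \<otimes> snd (d x) = snd (d x)" by (metis snd_conv)
      then show ?thesis using g snd_d[of x] by simp
    qed
    show "i = j" if "g \<in> carrier G" "act g (e (i, \<one>)) = e (j, \<one>)" for g i j
      using that by (simp add: act_def d_e S e_eq)
  qed
  then show ?thesis by blast
qed

text \<open>
  Faithfulness and high transitivity of the action of the free product, phrased with words. In this
  form the statement is visibly symmetric in \<open>G\<close> and \<open>H\<close>.
\<close>

definition faithful_highly_transitive_pair ::
  "('a, 'm) monoid_scheme \<Rightarrow> ('b, 'n) monoid_scheme \<Rightarrow> ('a \<Rightarrow> 'x \<Rightarrow> 'x) \<Rightarrow> ('b \<Rightarrow> 'x \<Rightarrow> 'x) \<Rightarrow> bool" where
  "faithful_highly_transitive_pair G H a b \<longleftrightarrow> free_action_pair G H a b \<and>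
     (\<forall>w \<in> reduced_words G H. w \<noteq> [] \<longrightarrow> (\<exists>x. run a b w x \<noteq> x)) \<and>
     (\<forall>xs ys. distinct xs \<longrightarrow> distinct ys \<longrightarrow> length xs = length ys \<longrightarrow>
        (\<exists>w \<in> words G H. map (run a b w) xs = ys))"

lemma faithful_highly_transitive_pairD:
  assumes "faithful_highly_transitive_pair G H a b"
  shows "free_action_pair G H a b"
    and "w \<in> reduced_words G H \<Longrightarrow> w \<noteq> [] \<Longrightarrow> \<exists>x. run a b w x \<noteq> x"
    and "distinct xs \<Longrightarrow> distinct ys \<Longrightarrow> length xs = length ys \<Longrightarrow>
      \<exists>w \<in> words G H. map (run a b w) xs = ys"
  using assms unfolding faithful_highly_transitive_pair_def by blast+

text \<open>
  Any tuple can be carried to any other one by way of a third that is disjoint from both.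
\<close>

lemma disjoint_transport_imp_transport:
  fixes xs ys :: "nat list"
  assumes disj: "\<And>xs ys. distinct xs \<Longrightarrow> distinct ys \<Longrightarrow> length xs = length ys \<Longrightarrow>
      set xs \<inter> set ys = {} \<Longrightarrow> \<exists>w \<in> words G H. map (run a b w) xs = ys"
    and "distinct xs" "distinct ys" "length xs = length ys"
  shows "\<exists>w \<in> words G H. map (run a b w) xs = ys"
proof -
  define m where "m = Suc (Max (insert 0 (set xs \<union> set ys)))"
  define zs where "zs = [m..<m + length xs]"
  have "x < m" if "x \<in> set xs \<union> set ys" for x
    using that by (simp add: m_def less_Suc_eq_le)
  moreover have "m \<le> z" if "z \<in> set zs" for z
    using that by (simp add: zs_def)
  ultimately have d: "set xs \<inter> set zs = {}" "set zs \<inter> set ys = {}"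
    by (meson UnI1 UnI2 disjoint_iff leD)+
  have zs: "distinct zs" "length zs = length xs" by (simp_all add: zs_def)
  obtain u where u: "u \<in> words G H" "map (run a b u) xs = zs"
    using disj[OF assms(2) zs(1) zs(2)[symmetric] d(1)] by blast
  obtain v where v: "v \<in> words G H" "map (run a b v) zs = ys"
    using disj[OF zs(1) assms(3) _ d(2)] zs(2) assms(4) by auto
  have "map (run a b (v @ u)) xs = map (run a b v) (map (run a b u) xs)" by simp
  then show ?thesis using u v by (intro bexI[of _ "v @ u"]) simp_all
qed

lemma (in large_spread_pair) generic_pair:
  assumes "countable (carrier G)" "countable (carrier H)"
  shows "\<exists>b'. faithful_highly_transitive_pair G H a b'"
proof -
  define moves where "moves w = (\<lambda>\<tau>. \<exists>x. run a (conj_act \<tau> b) w x \<noteq> x)" for w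
  define transports where "transports c = (\<lambda>\<tau>. \<exists>w \<in> words G H. \<forall>x \<in> set (fst c).
      run a (conj_act \<tau> b) w x = the (map_of (zip (fst c) (snd c)) x))" for c :: "nat list \<times> nat list"
  \<comment> \<open>A tuple \<open>xs\<close> and its prescribed image \<open>ys\<close>; lists over \<open>\<nat>\<close> keep the family countable.\<close>
  define C :: "(nat list \<times> nat list) set" where
    "C = {(xs, ys). distinct xs \<and> distinct ys \<and> length xs = length ys \<and> set xs \<inter> set ys = {}}"
  have map_of: "map (\<lambda>x. the (map_of (zip xs ys) x)) xs = ys"
    if "distinct xs" "length xs = length ys" for xs ys :: "nat list"
    using that by (intro nth_equalityI) (auto simp: map_of_zip_nth)
  have "\<exists>\<tau>. bij \<tau> \<and> (\<forall>R \<in> moves ` (reduced_words G H - {[]}) \<union> transports ` C. R \<tau>)"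
  proof (rule generic_bijection)
    have "countable (words G H)"
      unfolding words_def using assms by (intro countable_lists) auto
    then have "countable (reduced_words G H)"
      by (rule countable_subset[OF reduced_words_subset_words])
    then show "countable (moves ` (reduced_words G H - {[]}) \<union> transports ` C)" by auto
    fix R
    assume "R \<in> moves ` (reduced_words G H - {[]}) \<union> transports ` C"
    then show "dense R"
    proof
      assume "R \<in> moves ` (reduced_words G H - {[]})"
      then show ?thesis using dense_moves by (auto simp: moves_def)
    next
      assume "R \<in> transports ` C"
      then obtain xs ys where R: "R = transports (xs, ys)" and C: "(xs, ys) \<in> C" by auto
      let ?\<pi> = "\<lambda>x. the (map_of (zip xs ys) x)"
      have eq: "map ?\<pi> xs = ys" using C by (intro map_of) (auto simp: C_def)
      have "distinct (map ?\<pi> xs)" using C unfolding eq by (auto simp: C_def)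
      moreover have "?\<pi> ` set xs = set ys" using eq by (metis set_map)
      ultimately have "inj_on ?\<pi> (set xs)" "?\<pi> ` set xs \<inter> set xs = {}"
        using C by (auto simp: distinct_map C_def)
      then show ?thesis using dense_transports[of "set xs" ?\<pi>] by (simp add: R transports_def)
    qed
  qed
  then obtain \<tau> where \<tau>: "bij \<tau>"
    and all: "\<forall>R \<in> moves ` (reduced_words G H - {[]}) \<union> transports ` C. R \<tau>"
    by (elim exE conjE)
  have R: "R \<tau>" if "R \<in> moves ` (reduced_words G H - {[]}) \<union> transports ` C" for R
    using bspec[OF all that] .
  have "\<exists>w \<in> words G H. map (run a (conj_act \<tau> b) w) xs = ys"
    if "distinct xs" "distinct ys" "length xs = length ys" "set xs \<inter> set ys = {}" for xs ys
  proof -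
    have "(xs, ys) \<in> C" using that by (simp add: C_def)
    then have "transports (xs, ys) \<tau>" using R[of "transports (xs, ys)"] by blast
    then obtain w where "w \<in> words G H"
      "\<forall>x \<in> set xs. run a (conj_act \<tau> b) w x = the (map_of (zip xs ys) x)"
      unfolding transports_def fst_conv snd_conv by blast
    moreover from this(2) have "map (run a (conj_act \<tau> b) w) xs = ys"
      using map_of[OF that(1,3)] by (metis map_cong)
    ultimately show ?thesis by blast
  qed
  then have "\<exists>w \<in> words G H. map (run a (conj_act \<tau> b) w) xs = ys"
    if "distinct xs" "distinct ys" "length xs = length ys" for xs ys
    using disjoint_transport_imp_transport[of G H a "conj_act \<tau> b" xs ys] that by blast
  moreover have "\<exists>x. run a (conj_act \<tau> b) w x \<noteq> x" if "w \<in> reduced_words G H" "w \<noteq> []" for w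
    using R[of "moves w"] that by (auto simp: moves_def)
  ultimately show ?thesis
    using spread_pair_conj[OF \<tau>] by (auto simp: faithful_highly_transitive_pair_def)
qed

section \<open>Exchanging the factors\<close>

abbreviation swap_sum :: "'a + 'b \<Rightarrow> 'b + 'a" where
  "swap_sum \<equiv> case_sum Inr Inl"

lemma run_swap: "run a b (map swap_sum w) x = run b a w x"
proof (induction w)
  case (Cons y w)
  then show ?case by (cases y) auto
qed simp

lemma words_swap: "w \<in> words G H \<Longrightarrow> map swap_sum w \<in> words H G"
  by (induction rule: words_induct) auto

lemma reduced_words_swap:
  assumes "w \<in> reduced_words G H"
  shows "map swap_sum w \<in> reduced_words H G"
  using assms
proof (induction w)
  case (Cons y w)
  then show ?case
    by (cases y; cases w; cases "hd w") (auto simp: Cons_reduced_iff)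
qed simp

lemma faithful_highly_transitive_pair_swap:
  fixes a :: "'a \<Rightarrow> 'x \<Rightarrow> 'x" and b :: "'b \<Rightarrow> 'x \<Rightarrow> 'x"
  assumes "faithful_highly_transitive_pair G H a b"
  shows "faithful_highly_transitive_pair H G b a"
  unfolding faithful_highly_transitive_pair_def
proof (intro conjI ballI allI impI)
  show "free_action_pair H G b a"
    using faithful_highly_transitive_pairD(1)[OF assms] by (auto simp: free_action_pair_def)
next
  fix w assume "w \<in> reduced_words H G" "w \<noteq> []"
  then have "\<exists>x. run a b (map swap_sum w) x \<noteq> x"
    using reduced_words_swap[of w H G] by (intro faithful_highly_transitive_pairD(2)[OF assms]) auto
  then show "\<exists>x. run b a w x \<noteq> x" by (simp add: run_swap)
next
  fix xs ys :: "'x list"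
  assume "distinct xs" "distinct ys" "length xs = length ys"
  then obtain w where w: "w \<in> words G H" "map (run a b w) xs = ys"
    using faithful_highly_transitive_pairD(3)[OF assms] by metis
  moreover have "run b a (map swap_sum w) = run a b w" by (simp add: fun_eq_iff run_swap)
  ultimately show "\<exists>w \<in> words H G. map (run b a w) xs = ys"
    using words_swap by (intro bexI[of _ "map swap_sum w"]) auto
qed

section \<open>Groups of order two\<close>

lemma (in group) order_two_iso:
  assumes "s \<noteq> \<one>" "carrier G = {\<one>, s}"
  shows "G \<cong> integer_mod_group 2"
proof -
  have s: "s \<in> carrier G" using assms(2) by simp
  then have "s \<otimes> s \<in> {\<one>, s}" using assms(2) by (metis m_closed)
  then have ss: "s \<otimes> s = \<one>" using s assms(1) by auto
  have "(\<lambda>x. if x = \<one> then 0 else 1) \<in> iso G (integer_mod_group 2)"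
    unfolding iso_def hom_def bij_betw_def inj_on_def carrier_integer_mod_group
    using assms s ss by (auto simp: image_iff)
  then show ?thesis by (auto simp: is_iso_def)
qed

lemma (in group) two_nontrivial_elements:
  assumes "\<not> trivial_group G" "\<not> G \<cong> integer_mod_group 2"
  obtains h h' where "h \<in> carrier G" "h \<noteq> \<one>" "h' \<in> carrier G" "h' \<noteq> \<one>" "h \<noteq> h'"
proof -
  obtain h where h: "h \<in> carrier G" "h \<noteq> \<one>"
    using assms(1) one_closed by (auto simp: trivial_group_def)
  then have "carrier G \<noteq> {\<one>, h}" using order_two_iso assms(2) by blast
  with h that show thesis by blast
qed

lemma (in group) order_two_elements:
  assumes "G \<cong> integer_mod_group 2"
  obtains s where "carrier G = {\<one>, s}" "s \<noteq> \<one>" "s \<otimes> s = \<one>"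
proof -
  have "card (carrier G) = 2"
    using iso_same_card[OF assms] by (simp add: carrier_integer_mod_group)
  then obtain s where s: "carrier G = {\<one>, s}" "s \<noteq> \<one>"
    using one_closed by (metis card_2_iff doubleton_eq_iff insertE singletonD)
  then have "s \<otimes> s \<in> {\<one>, s}" by (metis insertI1 insert_commute m_closed)
  moreover have "s \<otimes> s \<noteq> s" using s by (metis insertI1 insert_commute l_cancel_one')
  ultimately show thesis using that s by blast
qed

section \<open>Actions of the free product\<close>

context free_action_pair
begin

lemma run_letter_mult:
  assumes "y \<in> Inl ` carrier G \<union> Inr ` carrier H" "w \<in> reduced_words G H"
  shows "run a b (letter_mult G H y w) x = case_sum a b y (run a b w x)"
  using assms
  by (cases y; cases w; cases "hd w")
     (auto simp: Cons_reduced_iff A.act_mult[symmetric] B.act_mult[symmetric])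

lemma foldr_letter_mult_word:
  assumes "u \<in> words G H" "w \<in> reduced_words G H"
  shows "foldr (letter_mult G H) u w \<in> reduced_words G H"
  using foldr_letter_mult_reduced[OF A.is_group B.is_group _ assms(2)] assms(1)
  by (auto simp: words_def)

lemma run_foldr_letter_mult:
  assumes "u \<in> words G H" "w \<in> reduced_words G H"
  shows "run a b (foldr (letter_mult G H) u w) x = run a b u (run a b w x)"
  using assms(1)
  by (induction rule: words_induct) (auto simp: run_letter_mult foldr_letter_mult_word assms(2))

lemma group_action_run: "group_action (free_product G H) UNIV (run a b)"
proof -
  have bij: "bij (run a b w)" if "w \<in> words G H" for w
  proof -
    obtain v where "\<forall>x. run a b v (run a b w x) = x \<and> run a b w (run a b v x) = x"
      using inverse_word[OF \<open>w \<in> words G H\<close>] by blast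
    then show ?thesis by (intro o_bij[of "run a b v"]) (simp_all add: fun_eq_iff)
  qed
  have "run a b \<in> hom (free_product G H) (BijGroup UNIV)"
  proof (rule homI)
    fix u w
    assume "u \<in> carrier (free_product G H)" "w \<in> carrier (free_product G H)"
    then have u: "u \<in> words G H" and w: "w \<in> reduced_words G H" "w \<in> words G H"
      using reduced_words_subset_words by auto
    show "run a b u \<in> carrier (BijGroup UNIV)"
      using bij[OF u] by (simp add: BijGroup_def Bij_def)
    show "run a b (u \<otimes>\<^bsub>free_product G H\<^esub> w) = run a b u \<otimes>\<^bsub>BijGroup UNIV\<^esub> run a b w"
      using bij[OF u] bij[OF w(2)]
      by (simp add: BijGroup_def Bij_def compose_def fun_eq_iff run_foldr_letter_mult[OF u w(1)])
  qed
  then show ?thesis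
    by (intro group_action.intro group_hom.intro group_hom_axioms.intro group_BijGroup
        group_free_product A.is_group B.is_group)
qed

end

lemma faithful_highly_transitive_pair_action:
  assumes "faithful_highly_transitive_pair G H a b"
  shows "faithful_action (free_product G H) UNIV (run a b)"
    and "highly_transitive_action (free_product G H) UNIV (run a b)"
proof -
  interpret free_action_pair G H a b
    using faithful_highly_transitive_pairD(1)[OF assms] .
  interpret group_action "free_product G H" UNIV "run a b" by (rule group_action_run)
  interpret group_hom "free_product G H" "BijGroup UNIV" "run a b" by (rule group_hom)
  have "w = []" if "w \<in> reduced_words G H" "run a b w = (\<lambda>x \<in> UNIV. x)" for w
    using faithful_highly_transitive_pairD(2)[OF assms, of w] that by auto
  then have "inj_on (run a b) (carrier (free_product G H))"
    unfolding inj_on_one_iff by (simp add: BijGroup_def)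
  then show "faithful_action (free_product G H) UNIV (run a b)"
    by unfold_locales
  have "\<exists>w \<in> carrier (free_product G H). map (run a b w) xs = ys"
    if "xs \<in> distinct_tuples k UNIV" "ys \<in> distinct_tuples k UNIV" for k xs ys
  proof -
    have "distinct xs" "distinct ys" "length xs = length ys"
      using that by (auto simp: distinct_tuples_def)
    then obtain w where w: "w \<in> words G H" "map (run a b w) xs = ys"
      using faithful_highly_transitive_pairD(3)[OF assms] by metis
    have "run a b (foldr (letter_mult G H) w []) = run a b w"
      using run_foldr_letter_mult[OF w(1)] by (simp add: fun_eq_iff)
    with w show ?thesis
      using foldr_letter_mult_word[OF w(1), of "[]"]
      by (intro bexI[of _ "foldr (letter_mult G H) w []"]) auto
  qed
  then show "highly_transitive_action (free_product G H) UNIV (run a b)"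
    unfolding highly_transitive_action_iff using group_action_run by blast
qed

section \<open>The infinite dihedral group\<close>

text \<open>
  Let \<open>A\<close> and \<open>B\<close> be the involutions of the two factors and \<open>c = B A\<close>, so that \<open>c\<^sup>-\<^sup>1 = A B\<close>. If
  \<open>c\<close> moves a point \<open>x\<close>, then an element fixing \<open>x\<close> carries \<open>c x\<close> to \<open>c x\<close> or \<open>c\<^sup>-\<^sup>1 x\<close>, and the
  action is not 2-transitive. Otherwise \<open>A = B\<close>, orbits have at most two points, and the action is
  not even transitive.
\<close>

lemma infinite_dihedral_not_highly_transitive:
  assumes "group G" "group H" "G \<cong> integer_mod_group 2" "H \<cong> integer_mod_group 2"
    and "infinite X"
  shows "\<not> highly_transitive_action (free_product G H) X \<phi>"
proof
  assume ht: "highly_transitive_action (free_product G H) X \<phi>"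
  interpret G: group G by fact
  interpret H: group H by fact
  interpret group_action "free_product G H" X \<phi>
    using ht by (simp add: highly_transitive_action_iff)
  obtain s where s: "carrier G = {\<one>\<^bsub>G\<^esub>, s}" "s \<noteq> \<one>\<^bsub>G\<^esub>" "s \<otimes>\<^bsub>G\<^esub> s = \<one>\<^bsub>G\<^esub>"
    using G.order_two_elements[OF assms(3)] .
  obtain t where t: "carrier H = {\<one>\<^bsub>H\<^esub>, t}" "t \<noteq> \<one>\<^bsub>H\<^esub>" "t \<otimes>\<^bsub>H\<^esub> t = \<one>\<^bsub>H\<^esub>"
    using H.order_two_elements[OF assms(4)] .
  define A where "A = \<phi> [Inl s]"
  define B where "B = \<phi> [Inr t]"
  have red: "[Inl s] \<in> reduced_words G H" "[Inr t] \<in> reduced_words G H"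
    using s t by (auto simp: Cons_reduced_iff)
  have mem: "\<phi> w x \<in> X" if "w \<in> reduced_words G H" "x \<in> X" for w x
    using element_image[of w x] that by auto
  have A_mem: "A x \<in> X" and B_mem: "B x \<in> X" if "x \<in> X" for x
    using mem red that by (auto simp: A_def B_def)
  have one: "\<phi> [] x = x" if "x \<in> X" for x
    using fun_cong[OF id_eq_one, of x] that by simp
  have AA: "A (A x) = x" and BB: "B (B x) = x" if "x \<in> X" for x
    using composition_rule[OF that, of "[Inl s]" "[Inl s]"]
      composition_rule[OF that, of "[Inr t]" "[Inr t]"] red s t one[OF that]
    by (simp_all add: A_def B_def)
  have letter_cases: "(\<forall>x \<in> X. \<phi> (y # w) x = A (\<phi> w x)) \<or> (\<forall>x \<in> X. \<phi> (y # w) x = B (\<phi> w x))"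
    if "y # w \<in> reduced_words G H" for y w
  proof -
    have y: "[y] \<in> reduced_words G H" "w \<in> reduced_words G H" "y = Inl s \<or> y = Inr t"
      using that s t by (auto simp: Cons_reduced_iff)
    have "\<phi> (y # w) x = \<phi> [y] (\<phi> w x)" if "x \<in> X" for x
      using composition_rule[OF that, of "[y]" w] y(1,2)
        cons_letter_eq_letter_mult[OF \<open>y # w \<in> reduced_words G H\<close>] by simp
    with y(3) show ?thesis unfolding A_def B_def by blast
  qed
  have twist: "\<phi> w (B (A x)) \<in> {B (A (\<phi> w x)), A (B (\<phi> w x))}"
    if "w \<in> reduced_words G H" "x \<in> X" for w x
    using that(1)
  proof (induction w)
    case Nil
    then show ?case using one that(2) A_mem B_mem by simp
  next
    case (Cons y w)
    then have w: "w \<in> reduced_words G H" by (simp add: Cons_reduced_iff)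
    have "B (A x) \<in> X" using that(2) A_mem B_mem by simp
    have v: "\<phi> w x \<in> X" "A (\<phi> w x) \<in> X" "B (\<phi> w x) \<in> X"
      using mem[OF w that(2)] A_mem B_mem by auto
    from letter_cases[OF Cons.prems] show ?case
      using Cons.IH[OF w] AA BB that(2) \<open>B (A x) \<in> X\<close> v by auto
  qed
  have trans: "\<exists>w \<in> reduced_words G H. map (\<phi> w) xs = ys"
    if "length xs = length ys" "xs \<noteq> []" "distinct xs" "distinct ys" "set xs \<subseteq> X" "set ys \<subseteq> X" for xs ys
  proof -
    have "xs \<in> distinct_tuples (length xs) X" "ys \<in> distinct_tuples (length xs) X" "length xs \<ge> 1"
      using that by (auto simp: distinct_tuples_def Suc_le_eq)
    then show ?thesis using ht unfolding highly_transitive_action_iff by fastforce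
  qed
  show False
  proof (cases "\<exists>x \<in> X. B (A x) \<noteq> x")
    case True
    then obtain x where x: "x \<in> X" "B (A x) \<noteq> x" by blast
    obtain z where z: "z \<in> X" "z \<notin> {x, B (A x), A (B x)}"
      using assms(5) by (metis finite.emptyI finite_insert finite_subset subsetI)
    have "\<exists>w \<in> reduced_words G H. map (\<phi> w) [x, B (A x)] = [x, z]"
      using x z A_mem B_mem by (intro trans) auto
    then obtain w where "w \<in> reduced_words G H" "\<phi> w x = x" "\<phi> w (B (A x)) = z" by auto
    then show False using twist[of w x] x(1) z(2) by auto
  next
    case False
    then have AB: "A x = B x" if "x \<in> X" for x
      using that BB A_mem by metis
    obtain x where x: "x \<in> X" using assms(5) by (metis finite.emptyI ex_in_conv)
    obtain z where z: "z \<in> X" "z \<notin> {x, A x}"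
      using assms(5) by (metis finite.emptyI finite_insert finite_subset subsetI)
    have "\<phi> w x \<in> {x, A x}" if "w \<in> reduced_words G H" for w
      using that
    proof (induction w)
      case Nil
      then show ?case using one x by simp
    next
      case (Cons y w)
      then have w: "w \<in> reduced_words G H" by (simp add: Cons_reduced_iff)
      show ?case
        using Cons.IH[OF w] letter_cases[OF Cons.prems] AB AA x A_mem by auto
    qed
    moreover have "\<exists>w \<in> reduced_words G H. map (\<phi> w) [x] = [z]"
      using x z by (intro trans) auto
    ultimately show False using z by auto
  qed
qed

section \<open>The equivalence\<close>

theorem theorem0p1:
  fixes G :: "('a, 'm) monoid_scheme" and H :: "('b, 'n) monoid_scheme"
  assumes "group G" and "group H"
    and "\<not> trivial_group G" and "\<not> trivial_group H"
    and "countable (carrier G)" and "countable (carrier H)"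
  shows "(\<exists>(X :: nat set) \<phi>. countable X \<and> infinite X
            \<and> faithful_action (free_product G H) X \<phi>
            \<and> highly_transitive_action (free_product G H) X \<phi>)
     \<longleftrightarrow> (\<not> G \<cong> integer_mod_group 2 \<or> \<not> H \<cong> integer_mod_group 2)"
proof
  assume "\<exists>(X :: nat set) \<phi>. countable X \<and> infinite X
            \<and> faithful_action (free_product G H) X \<phi>
            \<and> highly_transitive_action (free_product G H) X \<phi>"
  then show "\<not> G \<cong> integer_mod_group 2 \<or> \<not> H \<cong> integer_mod_group 2"
    using infinite_dihedral_not_highly_transitive[OF assms(1,2)] by blast
next
  interpret G: group G by fact
  interpret H: group H by fact
  obtain a s where a: "spread_action G (a :: 'a \<Rightarrow> nat \<Rightarrow> nat) s"
    using G.spread_action_exists[OF assms(5)] by blast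
  obtain b t where b: "spread_action H (b :: 'b \<Rightarrow> nat \<Rightarrow> nat) t"
    using H.spread_action_exists[OF assms(6)] by blast
  obtain g where g: "g \<in> carrier G" "g \<noteq> \<one>\<^bsub>G\<^esub>"
    using assms(3) G.one_closed by (auto simp: trivial_group_def)
  obtain h where h: "h \<in> carrier H" "h \<noteq> \<one>\<^bsub>H\<^esub>"
    using assms(4) H.one_closed by (auto simp: trivial_group_def)
  assume "\<not> G \<cong> integer_mod_group 2 \<or> \<not> H \<cong> integer_mod_group 2"
  then have "\<exists>(a :: 'a \<Rightarrow> nat \<Rightarrow> nat) b. faithful_highly_transitive_pair G H a b"
  proof
    assume "\<not> H \<cong> integer_mod_group 2"
    then obtain k k' where k: "k \<in> carrier H" "k \<noteq> \<one>\<^bsub>H\<^esub>" "k' \<in> carrier H" "k' \<noteq> \<one>\<^bsub>H\<^esub>" "k \<noteq> k'"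
      using H.two_nontrivial_elements[OF assms(4)] by metis
    interpret large_spread_pair G H a b s t g k k'
      by (intro large_spread_pair.intro spread_pair.intro large_spread_pair_axioms.intro a b g k)
    show ?thesis using generic_pair[OF assms(5,6)] by blast
  next
    assume "\<not> G \<cong> integer_mod_group 2"
    then obtain k k' where k: "k \<in> carrier G" "k \<noteq> \<one>\<^bsub>G\<^esub>" "k' \<in> carrier G" "k' \<noteq> \<one>\<^bsub>G\<^esub>" "k \<noteq> k'"
      using G.two_nontrivial_elements[OF assms(3)] by metis
    interpret large_spread_pair H G b a t s h k k'
      by (intro large_spread_pair.intro spread_pair.intro large_spread_pair_axioms.intro a b h k)
    show ?thesis
      using generic_pair[OF assms(6,5)] faithful_highly_transitive_pair_swap by blast
  qed
  then obtain a :: "'a \<Rightarrow> nat \<Rightarrow> nat" and b where "faithful_highly_transitive_pair G H a b"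
    by blast
  from faithful_highly_transitive_pair_action[OF this]
  show "\<exists>(X :: nat set) \<phi>. countable X \<and> infinite X
            \<and> faithful_action (free_product G H) X \<phi>
            \<and> highly_transitive_action (free_product G H) X \<phi>"
    by (intro exI[of _ UNIV] exI[of _ "run a b"]) auto
qed

end
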